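(* For positive integers $n$ and $r$, the set of real symmetric $n\times n$ matrices of symmetric Barvinok rank at most $r$ has dimension $\binom{n+1}{2}-\binom{n-r+1}{2}$, which is the dimension of the classical variety of complex symmetric $n\times n$ matrices of rank at most $r$.
   Context: For $v\in\mathbb{R}^n$, $v^T\odot v$ is the symmetric matrix with entries $v_i+v_j$. The symmetric Barvinok rank of a real symmetric matrix $M$ is the smallest $r$ such that $M$ is the coordinatewise minimum of $r$ matrices of the form $v^T\odot v$, or $\infty$ if none exists. The set of matrices of rank at most $r$ is a finite union of polyhedral cones in the $\binom{n+1}{2}$-dimensional space of symmetric matrices, and its dimension is the maximal dimension of such a cone. Convention: $\binom{m}{2}=0$ for $m<2$. *)

theory Defs
  imports "HOL-Analysis.Analysis"
begin

section \<open>Symmetric Barvinok rank\<close>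

definition trop_sym_outer :: "real^'n \<Rightarrow> real^'n^'n" where
  "trop_sym_outer v = (\<chi> i j. v $ i + v $ j)"

text \<open>Coordinatewise minimum of \<open>A 0, \<dots>, A (r - 1)\<close>; only meaningful for \<open>r > 0\<close>.\<close>

definition trop_matrix_sum :: "nat \<Rightarrow> (nat \<Rightarrow> real^'n^'m) \<Rightarrow> real^'n^'m" where
  "trop_matrix_sum r A = (\<chi> i j. Min ((\<lambda>k. A k $ i $ j) ` {..<r}))"

text \<open>The infimum is the least element of the set if there is one, and \<open>\<infinity>\<close> if the set is empty.
  The case \<open>r = 0\<close> is excluded: the empty minimum is \<open>\<infinity>\<close>, which is not a real number.\<close>

definition sym_barvinok_rank :: "real^'n^'n \<Rightarrow> enat" where
  "sym_barvinok_rank M =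
     Inf {enat r | r. r > 0 \<and> (\<exists>v. M = trop_matrix_sum r (\<lambda>k. trop_sym_outer (v k)))}"

section \<open>Dimension of a finite union of polyhedral cones\<close>

definition polyhedral_cone :: "'a::euclidean_space set \<Rightarrow> bool" where
  "polyhedral_cone C \<longleftrightarrow> polyhedron C \<and> convex_cone C"

definition cone_decomposition :: "'a::euclidean_space set set \<Rightarrow> 'a set \<Rightarrow> bool" where
  "cone_decomposition F S \<longleftrightarrow> finite F \<and> F \<noteq> {} \<and> (\<forall>C\<in>F. polyhedral_cone C) \<and> \<Union>F = S"

text \<open>The dimension of a cone is the dimension of its linear span, which is what \<open>dim\<close> computes.
  The predicate asserts that \<open>S\<close> is a finite union of polyhedral cones, and that the
  maximal dimension of a cone is \<open>d\<close> whichever decomposition is chosen.\<close>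

definition has_conical_dim :: "'a::euclidean_space set \<Rightarrow> nat \<Rightarrow> bool" where
  "has_conical_dim S d \<longleftrightarrow>
     (\<exists>F. cone_decomposition F S) \<and> (\<forall>F. cone_decomposition F S \<longrightarrow> Max (dim ` F) = d)"

section \<open>Dimension of complex algebraic sets of matrices\<close>

inductive polynomial_fun :: "(complex^'n^'m \<Rightarrow> complex) \<Rightarrow> bool" where
  const: "polynomial_fun (\<lambda>_. c)"
| entry: "polynomial_fun (\<lambda>A. A $ i $ j)"
| add: "polynomial_fun f \<Longrightarrow> polynomial_fun g \<Longrightarrow> polynomial_fun (\<lambda>A. f A + g A)"
| mult: "polynomial_fun f \<Longrightarrow> polynomial_fun g \<Longrightarrow> polynomial_fun (\<lambda>A. f A * g A)"

definition zero_locus :: "(complex^'n^'m \<Rightarrow> complex) set \<Rightarrow> (complex^'n^'m) set" where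
  "zero_locus P = {A. \<forall>f\<in>P. f A = 0}"

definition zariski :: "(complex^'n^'m) topology" where
  "zariski = topology (\<lambda>U. \<exists>P \<subseteq> Collect polynomial_fun. U = - zero_locus P)"

lemma openin_zariski:
  fixes U :: "(complex^'n^'m) set"
  shows "openin zariski U \<longleftrightarrow> (\<exists>P \<subseteq> Collect polynomial_fun. U = - zero_locus P)"
proof -
  let ?L = "\<lambda>U :: (complex^'n^'m) set. \<exists>P \<subseteq> Collect polynomial_fun. U = - zero_locus P"
  have "istopology ?L"
    unfolding istopology_def
  proof (intro conjI allI impI)
    fix S T assume "?L S" "?L T"
    then obtain P Q where PQ: "P \<subseteq> Collect polynomial_fun" "Q \<subseteq> Collect polynomial_fun"
      "S = - zero_locus P" "T = - zero_locus Q" by blast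
    let ?R = "{\<lambda>A. f A * g A | f g. f \<in> P \<and> g \<in> Q}"
    have "?R \<subseteq> Collect polynomial_fun"
      using PQ(1,2) by (auto intro: polynomial_fun.mult)
    moreover have "S \<inter> T = - zero_locus ?R"
      unfolding PQ(3,4) by (fastforce simp: zero_locus_def)
    ultimately show "?L (S \<inter> T)" by blast
  next
    fix K assume "\<forall>U\<in>K. ?L U"
    then obtain P where P: "\<And>U. U \<in> K \<Longrightarrow> P U \<subseteq> Collect polynomial_fun \<and> U = - zero_locus (P U)"
      by metis
    have "\<Union>K = - zero_locus (\<Union>U\<in>K. P U)"
    proof -
      have "x \<in> \<Union>K \<longleftrightarrow> (\<exists>U\<in>K. x \<in> - zero_locus (P U))" for x
        using P by blast
      then show ?thesis by (auto simp: zero_locus_def)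
    qed
    moreover have "(\<Union>U\<in>K. P U) \<subseteq> Collect polynomial_fun"
      using P by blast
    ultimately show "?L (\<Union>K)" by blast
  qed
  then show ?thesis
    unfolding zariski_def by (simp add: topology_inverse')
qed

lemma topspace_zariski [simp]: "topspace zariski = (UNIV :: (complex^'n^'m) set)"
proof -
  have "openin zariski (UNIV :: (complex^'n^'m) set)"
    unfolding openin_zariski
    by (intro exI[of _ "{\<lambda>_. 1}"]) (auto simp: zero_locus_def intro: polynomial_fun.const)
  then show ?thesis using openin_subset by blast
qed

lemma closedin_zariski:
  "closedin zariski Z \<longleftrightarrow> (\<exists>P \<subseteq> Collect polynomial_fun. Z = zero_locus P)"
  unfolding closedin_def openin_zariski
  by (simp add: Compl_eq_Diff_UNIV[symmetric])

definition irreducible_closed :: "'a topology \<Rightarrow> 'a set \<Rightarrow> bool" where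
  "irreducible_closed X Z \<longleftrightarrow>
     closedin X Z \<and> Z \<noteq> {} \<and>
     (\<forall>A B. closedin X A \<and> closedin X B \<and> Z = A \<union> B \<longrightarrow> Z = A \<or> Z = B)"

text \<open>Supremum of the lengths \<open>k\<close> of chains \<open>Z 0 \<subset> \<dots> \<subset> Z k\<close> of irreducible closed subsets.\<close>

definition krull_dim :: "'a topology \<Rightarrow> enat" where
  "krull_dim X =
     Sup {enat k | k. \<exists>Z. (\<forall>i\<le>k. irreducible_closed X (Z i)) \<and> (\<forall>i<k. Z i \<subset> Z (Suc i))}"

end

theory Submission
  imports Defs
begin

text \<open>
  The tropical set is the union of the images of the polyhedral cones of all vector tuples for
  which the minimum in entry \<open>(i, j)\<close> is attained by a prescribed summand. On such a cone the
  tropical parametrization is the limit of the logarithmic differentials of the classical one,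
  \<open>x \<mapsto> x x\<^sup>T\<close>, along a curve \<open>exp (- t v)\<close>. In the classical differential, the entries that touch
  a set \<open>I\<close> of \<open>r\<close> indices with spanning rows \<open>x i\<close> determine all others, which bounds the rank.
  Conversely, near a suitable matrix the entries that touch \<open>r\<close> given indices can be prescribed.

  The same count governs the determinantal variety: choosing \<open>I\<close> with spanning rows writes a
  symmetric matrix of rank at most \<open>r\<close> as \<open>W S W\<^sup>T\<close> with one parameter per pair touching \<open>I\<close>.
  A strict chain of irreducible sets gives polynomials, each vanishing on one member and not on the
  next; their monomials are linearly independent on the last member, and counting these against
  monomials in the parameters bounds the length of the chain. Freeing the parameters one
  by one gives a chain of maximal length.\<close>

subsection \<open>Linear algebra and index pairs\<close>

text \<open>Gaussian elimination, one equation at a time. The index sets are arbitrary finite sets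
  because the unknowns will belong to exponent lists or basis matrices, the equations to exponent
  functions or index pairs.\<close>

lemma homogeneous_system_nontrivial:
  fixes T :: "'a \<Rightarrow> 'b \<Rightarrow> 'f::field"
  assumes "finite A" "finite B" "card B < card A"
  shows "\<exists>c. (\<exists>a\<in>A. c a \<noteq> 0) \<and> (\<forall>b\<in>B. (\<Sum>a\<in>A. c a * T a b) = 0)"
  using assms(2,1,3)
proof (induction B arbitrary: A T rule: finite_induct)
  case empty
  then obtain a where "a \<in> A" by fastforce
  then show ?case by (intro exI[of _ "\<lambda>_. 1"]) auto
next
  case (insert b B)
  show ?case
  proof (cases "\<forall>a\<in>A. T a b = 0")
    case True
    have "card B < card A" using insert by simp
    from insert.IH[OF insert.prems(1) this, of T] True show ?thesis by auto
  next
    case False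
    then obtain a0 where a0: "a0 \<in> A" "T a0 b \<noteq> 0" by blast
    let ?A = "A - {a0}"
    \<comment> \<open>Eliminates \<open>a0\<close>: from the coefficients of each other unknown, the
      multiple of those of \<open>a0\<close> is subtracted that clears equation
      \<open>b\<close>.\<close>
    define T' where "T' a b' = T a b' - T a b / T a0 b * T a0 b'" for a b'
    have "card B < card ?A" using insert a0 by simp
    from insert.IH[OF _ this, of T'] insert.prems obtain c where
      c: "\<exists>a\<in>?A. c a \<noteq> 0" "\<forall>b\<in>B. (\<Sum>a\<in>?A. c a * T' a b) = 0" by auto
    define s where "s = (\<Sum>a\<in>?A. c a * T a b)"
    define c' where "c' = c(a0 := - s / T a0 b)"
    have split: "(\<Sum>a\<in>A. c' a * T a b') = - s / T a0 b * T a0 b' + (\<Sum>a\<in>?A. c a * T a b')" for b'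
    proof -
      have "(\<Sum>a\<in>?A. c' a * T a b') = (\<Sum>a\<in>?A. c a * T a b')"
        by (rule sum.cong) (auto simp: c'_def)
      then show ?thesis
        using insert.prems(1) a0 by (simp add: sum.remove[of A a0] c'_def)
    qed
    have "(\<Sum>a\<in>?A. c a * T' a b') = (\<Sum>a\<in>?A. c a * T a b') - s / T a0 b * T a0 b'" for b'
      by (simp add: T'_def s_def algebra_simps sum_subtractf sum_distrib_left sum_distrib_right
          sum_divide_distrib)
    then have "(\<Sum>a\<in>A. c' a * T a b') = 0" if "b' \<in> insert b B" for b'
      using that c(2) a0(2) by (cases "b' = b") (auto simp: split s_def)
    moreover have "\<exists>a\<in>A. c' a \<noteq> 0" using c(1) by (auto simp: c'_def)
    ultimately show ?thesis by blast
  qed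
qed

text \<open>A basis of the row space is taken from the rows themselves. Choosing one index for each
  basis vector avoids counting equal rows twice.\<close>

lemma rows_spanned_by_few:
  fixes A :: "'f::field^'m^'n"
  shows "\<exists>I. card I \<le> rank A \<and> (\<forall>j. \<exists>w. \<forall>k. A $ j $ k = (\<Sum>i\<in>I. w i * A $ i $ k))"
proof -
  obtain B where B: "B \<subseteq> rows A" "vec.independent B" "rows A \<subseteq> vec.span B"
    "card B = vec.dim (rows A)"
    using vec.basis_exists by blast
  have "B \<subseteq> range (\<lambda>i. row i A)" using B(1) by (auto simp: rows_def)
  then obtain I where I: "inj_on (\<lambda>i. row i A) I" "B = (\<lambda>i. row i A) ` I"
    by (metis subset_image_inj)
  have "\<exists>w. \<forall>k. A $ j $ k = (\<Sum>i\<in>I. w i * A $ i $ k)" for j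
  proof -
    have "row j A \<in> vec.span B" using B(3) by (auto simp: rows_def)
    then obtain u where "row j A = (\<Sum>v\<in>B. u v *s v)"
      using vec.span_finite[of B] by (auto simp: I(2))
    then have "row j A = (\<Sum>i\<in>I. u (row i A) *s row i A)"
      by (simp add: I sum.reindex)
    then have "A $ j $ k = (\<Sum>i\<in>I. u (row i A) * A $ i $ k)" for k
      by (simp add: vec_eq_iff row_def)
    then show ?thesis by (intro exI[of _ "\<lambda>i. u (row i A)"]) auto
  qed
  moreover have "card I = rank A"
    using B(4) I by (simp add: row_rank_def_gen card_image)
  ultimately show ?thesis by (intro exI[of _ I]) auto
qed

lemma rank_le_card_if_rows_spanned:
  fixes A :: "'f::field^'m^'n"
  assumes "finite I" "\<And>j. row j A = (\<Sum>i\<in>I. w j i *s u i)"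
  shows "rank A \<le> card I"
proof -
  have "rows A \<subseteq> vec.span (u ` I)"
    unfolding rows_def using assms(2) by (auto intro!: vec.span_sum vec.span_scale intro: vec.span_base)
  then have "vec.dim (rows A) \<le> card (u ` I)"
    using assms(1) by (intro vec.dim_le_card) auto
  also have "\<dots> \<le> card I" using assms(1) by (rule card_image_le)
  finally show ?thesis by (simp add: row_rank_def_gen)
qed

section \<open>Counting the independent entries of a symmetric matrix\<close>

text \<open>Unordered pairs, with \<open>{i, i}\<close> for a diagonal position, stand for the
  independent entries of a symmetric matrix; those collected here lie in a row or column indexed by
  \<open>I\<close>.\<close>

definition pairs_touching :: "'a set \<Rightarrow> 'a set set" where
  "pairs_touching I = {{i, j} | i j. i \<in> I}"

lemma finite_pairs_touching [simp]: "finite (pairs_touching (I :: 'a::finite set))"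
  by (rule finite)

lemma card_pairs_within:
  assumes "finite A"
  shows "card {{i, j} | i j. i \<in> A \<and> j \<in> A} = card A + 1 choose 2"
proof -
  have "{{i, j} | i j. i \<in> A \<and> j \<in> A} = {X. X \<subseteq> A \<and> card X = 1} \<union> {X. X \<subseteq> A \<and> card X = 2}"
    (is "?L = ?R")
  proof
    show "?L \<subseteq> ?R" by (auto simp: card_2_iff card_1_singleton_iff)
    show "?R \<subseteq> ?L"
    proof
      fix X assume "X \<in> ?R"
      then consider a where "X = {a}" "a \<in> A" | a b where "X = {a, b}" "a \<in> A" "b \<in> A"
        by (auto simp: card_1_singleton_iff card_2_iff)
      then show "X \<in> ?L" by cases auto
    qed
  qed
  moreover have "card ?R = card {X. X \<subseteq> A \<and> card X = 1} + card {X. X \<subseteq> A \<and> card X = 2}"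
    using assms by (intro card_Un_disjoint) auto
  moreover have "\<dots> = (card A choose 1) + (card A choose 2)"
    using assms by (simp add: n_subsets)
  ultimately show ?thesis by (simp add: numeral_2_eq_2)
qed

text \<open>A pair fails to touch \<open>I\<close> exactly when it lies within the complement; the
  binomials count all pairs and those within the complement.\<close>

lemma card_pairs_touching:
  fixes I :: "'n::finite set"
  shows "card (pairs_touching I) = (CARD('n) + 1 choose 2) - (CARD('n) - card I + 1 choose 2)"
proof -
  let ?P = "\<lambda>A :: 'n set. {{i, j} | i j. i \<in> A \<and> j \<in> A}"
  have "pairs_touching I = ?P UNIV - ?P (- I)"
    by (auto simp: pairs_touching_def doubleton_eq_iff) metis
  moreover have "?P (- I) \<subseteq> ?P UNIV" by blast
  ultimately have "card (pairs_touching I) = card (?P UNIV) - card (?P (- I))"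
    by (simp add: card_Diff_subset)
  then show ?thesis
    by (simp only: card_pairs_within[OF finite] Compl_eq_Diff_UNIV card_Diff_subset[OF finite subset_UNIV])
qed

lemma card_pairs_touching_le:
  fixes I :: "'n::finite set"
  assumes "card I \<le> r"
  shows "card (pairs_touching I) \<le> (CARD('n) + 1 choose 2) - (CARD('n) + 1 - r choose 2)"
  unfolding card_pairs_touching
  using assms by (intro diff_le_mono2 binomial_right_mono) linarith

lemma card_pairs_touching_min:
  fixes I :: "'n::finite set"
  assumes "card I = min r CARD('n)"
  shows "card (pairs_touching I) = (CARD('n) + 1 choose 2) - (CARD('n) + 1 - r choose 2)"
proof (cases "r \<le> CARD('n)")
  case True
  then show ?thesis using assms by (simp add: card_pairs_touching Suc_diff_le)
next
  \<comment> \<open>\<open>I\<close> is the whole index set here. The subtrahends are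
    \<open>1 choose 2\<close> in the count and, by truncated subtraction, \<open>0 choose 2\<close>
    in the claim; both are 0.\<close>
  case False
  then have "CARD('n) + 1 - r = 0" by simp
  then show ?thesis using assms False by (simp add: card_pairs_touching binomial_eq_0)
qed

subsection \<open>Irreducible sets and polynomial parametrizations\<close>

text \<open>Bounds the degree in each parameter separately instead of the total degree: the
  exponents then fill a box with \<open>(D + 1) ^ card B\<close> elements.\<close>

definition box_degree_le :: "'b set \<Rightarrow> nat \<Rightarrow> (('b \<Rightarrow> complex) \<Rightarrow> complex) \<Rightarrow> bool" where
  "box_degree_le B D g \<longleftrightarrow>
     (\<exists>T. \<forall>c. g c = (\<Sum>\<beta>\<in>PiE B (\<lambda>_. {..D}). T \<beta> * (\<Prod>b\<in>B. c b ^ \<beta> b)))"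

lemma box_degree_le_monom:
  assumes "finite B" "\<And>b. b \<in> B \<Longrightarrow> e b \<le> D"
  shows "box_degree_le B D (\<lambda>c. a * (\<Prod>b\<in>B. c b ^ e b))"
proof -
  have "restrict e B \<in> PiE B (\<lambda>_. {..D})" using assms(2) by auto
  moreover have "finite (PiE B (\<lambda>_. {..D}))" using assms(1) by (intro finite_PiE) auto
  ultimately have eq: "a * (\<Prod>b\<in>B. c b ^ e b) = (\<Sum>\<beta>\<in>PiE B (\<lambda>_. {..D}).
      (if \<beta> = restrict e B then a else 0) * (\<Prod>b\<in>B. c b ^ \<beta> b))" for c
    by (simp add: if_distrib[of "\<lambda>x. x * _"] sum.delta cong: if_cong)
  show ?thesis unfolding box_degree_le_def
    by (intro exI[of _ "\<lambda>\<beta>. if \<beta> = restrict e B then a else 0"] allI eq)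
qed

lemma box_degree_le_add:
  assumes "box_degree_le B D f" "box_degree_le B D g"
  shows "box_degree_le B D (\<lambda>c. f c + g c)"
proof -
  obtain S T where
    "\<And>c. f c = (\<Sum>\<beta>\<in>PiE B (\<lambda>_. {..D}). S \<beta> * (\<Prod>b\<in>B. c b ^ \<beta> b))"
    "\<And>c. g c = (\<Sum>\<beta>\<in>PiE B (\<lambda>_. {..D}). T \<beta> * (\<Prod>b\<in>B. c b ^ \<beta> b))"
    using assms unfolding box_degree_le_def by auto
  then show ?thesis unfolding box_degree_le_def
    by (intro exI[of _ "\<lambda>\<beta>. S \<beta> + T \<beta>"]) (simp add: distrib_right sum.distrib)
qed

lemma box_degree_le_const: "finite B \<Longrightarrow> box_degree_le B D (\<lambda>_. a)"
  using box_degree_le_monom[of B "\<lambda>_. 0" D a] by simp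

lemma box_degree_le_sum:
  assumes "finite B" "\<And>x. x \<in> A \<Longrightarrow> box_degree_le B D (f x)"
  shows "box_degree_le B D (\<lambda>c. \<Sum>x\<in>A. f x c)"
  using assms(2)
  by (induction A rule: infinite_finite_induct)
    (auto intro: box_degree_le_add box_degree_le_const assms(1))

lemma box_degree_le_mult:
  assumes "finite B" "box_degree_le B D f" "box_degree_le B D' g"
  shows "box_degree_le B (D + D') (\<lambda>c. f c * g c)"
proof -
  obtain S T where ST:
    "\<And>c. f c = (\<Sum>\<beta>\<in>PiE B (\<lambda>_. {..D}). S \<beta> * (\<Prod>b\<in>B. c b ^ \<beta> b))"
    "\<And>c. g c = (\<Sum>\<beta>\<in>PiE B (\<lambda>_. {..D'}). T \<beta> * (\<Prod>b\<in>B. c b ^ \<beta> b))"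
    using assms unfolding box_degree_le_def by auto
  have "f c * g c = (\<Sum>\<beta>\<in>PiE B (\<lambda>_. {..D}). \<Sum>\<gamma>\<in>PiE B (\<lambda>_. {..D'}).
      (S \<beta> * T \<gamma>) * (\<Prod>b\<in>B. c b ^ (\<beta> b + \<gamma> b)))" for c
    by (simp add: ST sum_product power_add prod.distrib ac_simps)
  moreover have "box_degree_le B (D + D') (\<lambda>c. \<Sum>\<beta>\<in>PiE B (\<lambda>_. {..D}). \<Sum>\<gamma>\<in>PiE B (\<lambda>_. {..D'}).
      (S \<beta> * T \<gamma>) * (\<Prod>b\<in>B. c b ^ (\<beta> b + \<gamma> b)))"
    by (intro box_degree_le_sum box_degree_le_monom assms(1))
      (auto intro!: add_mono dest!: PiE_mem)
  ultimately show ?thesis by presburger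
qed

text \<open>Multiplying by the constant 1, seen as a polynomial of degree at most
  \<open>D' - D\<close>, raises the bound.\<close>

lemma box_degree_le_mono:
  assumes "finite B" "box_degree_le B D f" "D \<le> D'"
  shows "box_degree_le B D' f"
  using box_degree_le_mult[OF assms(1,2) box_degree_le_const[OF assms(1), of "D' - D" 1]] assms(3)
  by simp

lemma box_degree_le_var:
  assumes "finite B" "b \<in> B"
  shows "box_degree_le B 1 (\<lambda>c. c b)"
proof -
  have "c b = 1 * (\<Prod>x\<in>B. c x ^ (if x = b then 1 else 0))" for c :: "'a \<Rightarrow> complex"
    using assms by (simp add: if_distrib[of "\<lambda>n. _ ^ n"] prod.delta cong: if_cong)
  then show ?thesis
    using box_degree_le_monom[of B "\<lambda>x. if x = b then 1 else 0" 1 1] assms(1) by simp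
qed

lemma box_degree_le_power:
  assumes "finite B" "box_degree_le B D f"
  shows "box_degree_le B (n * D) (\<lambda>c. f c ^ n)"
  using assms by (induction n) (auto intro: box_degree_le_const box_degree_le_mult)

text \<open>Along a line each parameter is a linear polynomial in \<open>t\<close>, so questions of
  nonvanishing reduce to one variable.\<close>

lemma box_degree_le_on_line:
  assumes "box_degree_le B D g"
  shows "\<exists>p. \<forall>t. g (\<lambda>b. u b + t * v b) = poly p t"
proof -
  obtain T where
    "\<And>c. g c = (\<Sum>\<beta>\<in>PiE B (\<lambda>_. {..D}). T \<beta> * (\<Prod>b\<in>B. c b ^ \<beta> b))"
    using assms unfolding box_degree_le_def by auto
  then show ?thesis
    by (intro exI[of _ "\<Sum>\<beta>\<in>PiE B (\<lambda>_. {..D}). smult (T \<beta>) (\<Prod>b\<in>B. [:u b, v b:] ^ \<beta> b)"])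
      (simp add: poly_sum poly_prod)
qed

definition polynomial_param :: "'b set \<Rightarrow> (('b \<Rightarrow> complex) \<Rightarrow> complex^'n^'m) \<Rightarrow> bool" where
  "polynomial_param B \<phi> \<longleftrightarrow> (\<forall>i j. \<exists>D. box_degree_le B D (\<lambda>c. \<phi> c $ i $ j))"

lemma polynomial_fun_param:
  assumes "finite B" "polynomial_param B \<phi>" "polynomial_fun f"
  shows "\<exists>D. box_degree_le B D (\<lambda>c. f (\<phi> c))"
  using assms(3)
proof induction
  case (const c)
  then show ?case using box_degree_le_const[OF assms(1)] by blast
next
  case (entry i j)
  then show ?case using assms(2) unfolding polynomial_param_def by blast
next
  case (add f g)
  then obtain D D' where "box_degree_le B D (\<lambda>c. f (\<phi> c))" "box_degree_le B D' (\<lambda>c. g (\<phi> c))"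
    by blast
  then show ?case
    by (intro exI[of _ "max D D'"] box_degree_le_add) (auto intro: box_degree_le_mono[OF assms(1)])
next
  case (mult f g)
  then show ?case using box_degree_le_mult[OF assms(1)] by blast
qed

section \<open>Irreducible closed sets and vanishing ideals\<close>

lemma polynomial_fun_sum:
  assumes "\<And>x. x \<in> A \<Longrightarrow> polynomial_fun (f x)"
  shows "polynomial_fun (\<lambda>z. \<Sum>x\<in>A. f x z)"
  using assms
  by (induction A rule: infinite_finite_induct) (auto intro: polynomial_fun.intros)

lemma polynomial_fun_prod:
  assumes "\<And>x. x \<in> A \<Longrightarrow> polynomial_fun (f x)"
  shows "polynomial_fun (\<lambda>z. \<Prod>x\<in>A. f x z)"
  using assms
  by (induction A rule: infinite_finite_induct) (auto intro: polynomial_fun.intros)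

lemma polynomial_fun_power: "polynomial_fun f \<Longrightarrow> polynomial_fun (\<lambda>z. f z ^ n)"
  using polynomial_fun_prod[of "{..<n}" "\<lambda>_. f"] by simp

lemma closedin_subtopology_zariski:
  "closedin (subtopology zariski X) Z \<longleftrightarrow>
     (\<exists>P\<subseteq>Collect polynomial_fun. Z = X \<inter> zero_locus P)"
  unfolding closedin_subtopology closedin_zariski by (metis Int_commute)

text \<open>\<open>Z\<close> is the union of the closed subsets where \<open>f\<close> and where
  \<open>g\<close> vanish, so it equals one of them. In other words, its vanishing ideal is
  prime.\<close>

lemma irreducible_closed_prime:
  assumes Z: "irreducible_closed (subtopology zariski X) Z"
    and fg: "polynomial_fun f" "polynomial_fun g" "\<And>z. z \<in> Z \<Longrightarrow> f z * g z = 0"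
  shows "(\<forall>z\<in>Z. f z = 0) \<or> (\<forall>z\<in>Z. g z = 0)"
proof -
  obtain P where P: "P \<subseteq> Collect polynomial_fun" "Z = X \<inter> zero_locus P"
    using Z unfolding irreducible_closed_def closedin_subtopology_zariski by blast
  have cl: "closedin (subtopology zariski X) {z \<in> Z. h z = 0}" if "polynomial_fun h" for h
    unfolding closedin_subtopology_zariski using P that
    by (intro exI[of _ "insert h P"]) (auto simp: zero_locus_def)
  have "Z = {z \<in> Z. f z = 0} \<union> {z \<in> Z. g z = 0}" using fg(3) by auto
  then have "Z = {z \<in> Z. f z = 0} \<or> Z = {z \<in> Z. g z = 0}"
    using Z cl[OF fg(1)] cl[OF fg(2)] unfolding irreducible_closed_def by blast
  then show ?thesis by blast
qed

lemma irreducible_closed_prime_prod: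
  assumes Z: "irreducible_closed (subtopology zariski X) Z" and "finite J"
    and "\<And>x. x \<in> J \<Longrightarrow> polynomial_fun (f x)" and "\<And>z. z \<in> Z \<Longrightarrow> (\<Prod>x\<in>J. f x z) = 0"
  shows "\<exists>x\<in>J. \<forall>z\<in>Z. f x z = 0"
  using assms(2-4)
proof (induction J rule: finite_induct)
  case empty
  \<comment> \<open>The empty product is 1, so the hypothesis contradicts
    \<open>Z \<noteq> {}\<close>.\<close>
  then show ?case using Z unfolding irreducible_closed_def by auto
next
  case (insert x J)
  have "(\<forall>z\<in>Z. f x z = 0) \<or> (\<forall>z\<in>Z. (\<Prod>x\<in>J. f x z) = 0)"
    using insert by (intro irreducible_closed_prime[OF Z] polynomial_fun_prod) auto
  then show ?case using insert by auto
qed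

lemma zero_locusD: "z \<in> zero_locus P \<Longrightarrow> f \<in> P \<Longrightarrow> f z = 0"
  by (simp add: zero_locus_def)

definition vanishing_ideal :: "(complex^'n^'m) set \<Rightarrow> (complex^'n^'m \<Rightarrow> complex) set" where
  "vanishing_ideal Y = {f. polynomial_fun f \<and> (\<forall>y\<in>Y. f y = 0)}"

lemma subset_zero_locus_vanishing_ideal: "Y \<subseteq> zero_locus (vanishing_ideal Y)"
  by (simp add: zero_locus_def vanishing_ideal_def subset_iff)

lemma zero_locus_antimono: "P \<subseteq> Q \<Longrightarrow> zero_locus Q \<subseteq> zero_locus P"
  by (simp add: zero_locus_def subset_iff)

lemma vanishing_ideal_antimono: "Y \<subseteq> Y' \<Longrightarrow> vanishing_ideal Y' \<subseteq> vanishing_ideal Y"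
  by (simp add: vanishing_ideal_def subset_iff)

text \<open>Every polynomial defining \<open>C\<close> vanishes on \<open>Y\<close>. Hence, for
  \<open>Y \<subseteq> X\<close>, the set on the left is the Zariski closure of \<open>Y\<close> in
  \<open>X\<close>.\<close>

lemma zero_locus_vanishing_ideal_minimal:
  assumes "closedin (subtopology zariski X) C" "Y \<subseteq> C"
  shows "X \<inter> zero_locus (vanishing_ideal Y) \<subseteq> C"
proof -
  obtain P where P: "P \<subseteq> Collect polynomial_fun" "C = X \<inter> zero_locus P"
    using assms(1) unfolding closedin_subtopology_zariski by metis
  have "f y = 0" if "f \<in> P" "y \<in> Y" for f y
    using zero_locusD[OF _ that(1), of y] assms(2) that(2) P(2) by blast
  then have "P \<subseteq> vanishing_ideal Y"
    using P(1) by (simp add: vanishing_ideal_def subset_iff)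
  from zero_locus_antimono[OF this] show ?thesis unfolding P(2) by (rule Int_mono[OF subset_refl])
qed

text \<open>Two polynomials that do not vanish identically on the image have a common nonzero on it,
  found on the image of a line.\<close>

lemma irreducible_closed_param:
  fixes \<phi> :: "('b \<Rightarrow> complex) \<Rightarrow> complex^'n^'m"
  assumes B: "finite B" "polynomial_param B \<phi>"
    and E: "E \<noteq> {}" "\<And>c c' t. c \<in> E \<Longrightarrow> c' \<in> E \<Longrightarrow> (\<lambda>b. c b + t * (c' b - c b)) \<in> E"
    and X: "\<phi> ` E \<subseteq> X"
  shows "irreducible_closed (subtopology zariski X) (X \<inter> zero_locus (vanishing_ideal (\<phi> ` E)))"
    (is "irreducible_closed _ ?Z")
  unfolding irreducible_closed_def
proof (intro conjI allI impI)
  have "vanishing_ideal (\<phi> ` E) \<subseteq> Collect polynomial_fun"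
    unfolding vanishing_ideal_def by (rule Collect_mono) simp
  then show "closedin (subtopology zariski X) ?Z"
    unfolding closedin_subtopology_zariski by (metis (no_types))
  have sub: "\<phi> ` E \<subseteq> ?Z" using X subset_zero_locus_vanishing_ideal by (rule Int_greatest)
  then show "?Z \<noteq> {}" using E(1) by blast
  fix A C assume AC: "closedin (subtopology zariski X) A \<and> closedin (subtopology zariski X) C
    \<and> ?Z = A \<union> C"
  have nonvanishing: "\<exists>h c. polynomial_fun h \<and> c \<in> E \<and> h (\<phi> c) \<noteq> 0 \<and> D \<subseteq> zero_locus {h}"
    if D: "closedin (subtopology zariski X) D" "\<not> \<phi> ` E \<subseteq> D" for D
  proof -
    obtain c where c: "c \<in> E" "\<phi> c \<notin> D" using D(2) by blast
    obtain P where P: "P \<subseteq> Collect polynomial_fun" "D = X \<inter> zero_locus P"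
      using D(1) unfolding closedin_subtopology_zariski by metis
    then have "\<phi> c \<notin> zero_locus P" using c X by blast
    then obtain h where "h \<in> P" "h (\<phi> c) \<noteq> 0" unfolding zero_locus_def by auto
    moreover from this P have "polynomial_fun h" "D \<subseteq> zero_locus {h}"
      using zero_locus_antimono[of "{h}" P] by auto
    ultimately show ?thesis using c(1) by metis
  qed
  have "\<phi> ` E \<subseteq> A \<or> \<phi> ` E \<subseteq> C"
  proof (rule ccontr)
    assume "\<not> ?thesis"
    then obtain f c g c' where f: "polynomial_fun f" "c \<in> E" "f (\<phi> c) \<noteq> 0" "A \<subseteq> zero_locus {f}"
      and g: "polynomial_fun g" "c' \<in> E" "g (\<phi> c') \<noteq> 0" "C \<subseteq> zero_locus {g}"
      using nonvanishing AC by metis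
    let ?l = "\<lambda>t b. c b + t * (c' b - c b)"
    have line: "\<exists>p. \<forall>t. h (\<phi> (?l t)) = poly p t" if h: "polynomial_fun h" for h
      using polynomial_fun_param[OF B h] box_degree_le_on_line by metis
    obtain p where p: "\<And>t. f (\<phi> (?l t)) = poly p t" using line[OF f(1)] by metis
    obtain q where q: "\<And>t. g (\<phi> (?l t)) = poly q t" using line[OF g(1)] by metis
    \<comment> \<open>The line passes through \<open>c\<close> at \<open>t = 0\<close> and through
      \<open>c'\<close> at \<open>t = 1\<close>. Each of its points is mapped into \<open>A\<close>
      or \<open>C\<close>, so the product of the two nonzero polynomials would vanish at every
      \<open>t\<close>.\<close>
    have "poly p 0 \<noteq> 0" "poly q 1 \<noteq> 0" using f(3) g(3) p[of 0] q[of 1] by simp_all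
    then have "p * q \<noteq> 0" by auto
    moreover have "poly (p * q) t = 0" for t
    proof -
      have "\<phi> (?l t) \<in> ?Z" using E(2)[OF f(2) g(2), of t] sub by blast
      then have "\<phi> (?l t) \<in> zero_locus {f} \<or> \<phi> (?l t) \<in> zero_locus {g}"
        using AC f(4) g(4) by blast
      then show ?thesis by (simp add: zero_locus_def p q)
    qed
    ultimately show False using poly_all_0_iff_0 by blast
  qed
  then have "?Z \<subseteq> A \<or> ?Z \<subseteq> C"
    using zero_locus_vanishing_ideal_minimal AC by metis
  then show "?Z = A \<or> ?Z = C" using AC by (metis Un_upper1 Un_upper2 subset_antisym)
qed

section \<open>Bounding chain lengths by counting monomials\<close>

text \<open>The head of the list is the exponent of the function with the highest index, so
  splitting it off isolates the last function of a chain.\<close>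

primrec list_monomial :: "(nat \<Rightarrow> 'a \<Rightarrow> complex) \<Rightarrow> nat list \<Rightarrow> 'a \<Rightarrow> complex" where
  "list_monomial f [] z = 1"
| "list_monomial f (j # xs) z = f (length xs) z ^ j * list_monomial f xs z"

definition exponents :: "nat \<Rightarrow> nat \<Rightarrow> nat list set" where
  "exponents s k = {xs. set xs \<subseteq> {..s} \<and> length xs = k}"

lemma finite_exponents: "finite (exponents s k)"
  unfolding exponents_def by (rule finite_lists_length_eq) simp

lemma card_exponents: "card (exponents s k) = (s + 1) ^ k"
  unfolding exponents_def by (simp add: card_lists_length_eq)

lemma sum_exponents_Suc:
  "(\<Sum>xs\<in>exponents s (Suc k). F xs) = (\<Sum>j<Suc s. \<Sum>xs\<in>exponents s k. F (j # xs))"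
proof -
  have "exponents s (Suc k) = (\<lambda>(j, xs). j # xs) ` ({..<Suc s} \<times> exponents s k)"
    by (auto simp: exponents_def length_Suc_conv image_iff)
  moreover have "inj_on (\<lambda>(j, xs). j # xs) ({..<Suc s} \<times> exponents s k)"
    by (auto simp: inj_on_def)
  ultimately show ?thesis
    by (simp add: sum.reindex sum.cartesian_product case_prod_unfold del: sum.lessThan_Suc)
qed

lemma polynomial_fun_list_monomial:
  assumes "\<And>i. i < length xs \<Longrightarrow> polynomial_fun (f i)"
  shows "polynomial_fun (list_monomial f xs)"
  using assms
proof (induction xs)
  case Nil
  have "list_monomial f [] = (\<lambda>_. 1)" by (rule ext) simp
  then show ?case using polynomial_fun.const by metis
next
  case (Cons j xs)
  have "list_monomial f (j # xs) = (\<lambda>z. f (length xs) z ^ j * list_monomial f xs z)"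
    by (rule ext) simp
  moreover have "polynomial_fun \<dots>"
    using Cons by (intro polynomial_fun.mult polynomial_fun_power) auto
  ultimately show ?case by simp
qed

text \<open>Reads the sum as a polynomial in \<open>f\<close>. On \<open>Y\<close> only the constant
  coefficient survives, so it vanishes on \<open>Y\<close>, hence on \<open>Z\<close>; the rest is
  \<open>f\<close> times a shorter sum, and primeness allows cancelling \<open>f\<close>.\<close>

lemma coefficients_vanish:
  assumes Z: "irreducible_closed (subtopology zariski X) Z" "Y \<subseteq> Z"
    and f: "polynomial_fun f" "\<And>z. z \<in> Y \<Longrightarrow> f z = 0" "\<exists>z\<in>Z. f z \<noteq> 0"
    and G: "\<And>j. j < n \<Longrightarrow> polynomial_fun (G j)"
      "\<And>j. j < n \<Longrightarrow> \<forall>z\<in>Y. G j z = 0 \<Longrightarrow> \<forall>z\<in>Z. G j z = 0"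
    and "\<And>z. z \<in> Z \<Longrightarrow> (\<Sum>j<n. f z ^ j * G j z) = 0" "j < n"
  shows "\<forall>z\<in>Z. G j z = 0"
  using G assms(8-)
proof (induction n arbitrary: G j)
  case 0
  then show ?case by simp
next
  case (Suc n)
  have split: "(\<Sum>j<Suc n. f z ^ j * G j z) = G 0 z + f z * (\<Sum>j<n. f z ^ j * G (Suc j) z)" for z
    by (simp add: sum.lessThan_Suc_shift sum_distrib_left mult.assoc del: sum.lessThan_Suc)
  have "G 0 z = 0" if "z \<in> Y" for z
  proof -
    have "G 0 z + f z * (\<Sum>j<n. f z ^ j * G (Suc j) z) = 0"
      using Suc.prems(3)[of z] Z(2) that unfolding split by blast
    then show ?thesis by (simp only: f(2)[OF that] mult_zero_left add_0_right)
  qed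
  then have G0: "\<forall>z\<in>Z. G 0 z = 0" using Suc.prems(2) by blast
  have "(\<forall>z\<in>Z. f z = 0) \<or> (\<forall>z\<in>Z. (\<Sum>j<n. f z ^ j * G (Suc j) z) = 0)"
    using Suc.prems(1,3) G0 f(1) unfolding split
    by (intro irreducible_closed_prime[OF Z(1)] polynomial_fun_sum polynomial_fun.mult
        polynomial_fun_power) auto
  then have zero: "(\<Sum>j<n. f z ^ j * G (Suc j) z) = 0" if "z \<in> Z" for z
    using f(3) that by blast
  have "\<forall>z\<in>Z. G (Suc j) z = 0" if "j < n" for j
    using Suc.IH[of "\<lambda>j. G (Suc j)" j, OF Suc.prems(1)[OF Suc_mono] Suc.prems(2)[OF Suc_mono] zero that] .
  then show ?case using G0 Suc.prems(4) less_Suc_eq_0_disj by metis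
qed

text \<open>Induction on the length. A relation on \<open>Z (Suc k)\<close> is a polynomial in the
  last function \<open>f k\<close>, which vanishes on \<open>Z k\<close> but not on
  \<open>Z (Suc k)\<close>; its coefficients are combinations of monomials in the earlier
  functions.\<close>

lemma chain_monomials_independent:
  assumes Z: "\<And>i. i \<le> k \<Longrightarrow> irreducible_closed (subtopology zariski X) (Z i)"
    and sub: "\<And>i. i < k \<Longrightarrow> Z i \<subseteq> Z (Suc i)"
    and f: "\<And>i. i < k \<Longrightarrow> polynomial_fun (f i)" "\<And>i z. i < k \<Longrightarrow> z \<in> Z i \<Longrightarrow> f i z = 0"
      "\<And>i. i < k \<Longrightarrow> \<exists>z\<in>Z (Suc i). f i z \<noteq> 0"
    and zero: "\<And>z. z \<in> Z k \<Longrightarrow> (\<Sum>xs\<in>exponents s k. c xs * list_monomial f xs z) = 0"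
    and "xs \<in> exponents s k"
  shows "c xs = 0"
  using assms
proof (induction k arbitrary: c xs)
  case 0
  have "Z 0 \<noteq> {}" using "0.prems"(1)[of 0] unfolding irreducible_closed_def by blast
  then obtain z where z: "z \<in> Z 0" by blast
  have "exponents s 0 = {[]}" by (auto simp: exponents_def)
  then show ?case using "0.prems"(6)[OF z] "0.prems"(7) by simp
next
  case (Suc k)
  define G where "G j z = (\<Sum>xs\<in>exponents s k. c (j # xs) * list_monomial f xs z)" for j z
  have len: "length xs = k" if "xs \<in> exponents s k" for xs using that by (simp add: exponents_def)
  have coeff: "c (j # xs) = 0" if G0: "\<forall>z\<in>Z k. G j z = 0" and xs: "xs \<in> exponents s k" for j xs
  proof -
    have "(\<Sum>xs\<in>exponents s k. c (j # xs) * list_monomial f xs z) = 0" if "z \<in> Z k" for z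
      using that G0 unfolding G_def by simp
    from Suc.IH[OF Suc.prems(1)[OF le_SucI] Suc.prems(2)[OF less_SucI] Suc.prems(3)[OF less_SucI]
        Suc.prems(4)[OF less_SucI] Suc.prems(5)[OF less_SucI] this xs]
    show ?thesis .
  qed
  have "(\<Sum>xs\<in>exponents s (Suc k). c xs * list_monomial f xs z) = (\<Sum>j<Suc s. f k z ^ j * G j z)" for z
    unfolding sum_exponents_Suc G_def sum_distrib_left
    by (intro sum.cong refl) (simp add: len ac_simps)
  then have sum0: "(\<Sum>j<Suc s. f k z ^ j * G j z) = 0" if "z \<in> Z (Suc k)" for z
    using Suc.prems(6)[OF that] by simp
  have poly: "polynomial_fun (G j)" for j
    unfolding G_def using Suc.prems(3)
    by (intro polynomial_fun_sum polynomial_fun.mult polynomial_fun.const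
        polynomial_fun_list_monomial) (simp add: len)
  obtain j ys where xs: "xs = j # ys" "j < Suc s" "ys \<in> exponents s k"
    using Suc.prems(7) by (auto simp: exponents_def length_Suc_conv)
  \<comment> \<open>A coefficient that vanishes on \<open>Z k\<close> has only zero scalars by
    induction, so it vanishes everywhere. This is the extension from \<open>Z k\<close> to
    \<open>Z (Suc k)\<close> that the cancellation asks for.\<close>
  have G0: "\<forall>z\<in>Z (Suc k). G j z = 0" if "\<forall>z\<in>Z k. G j z = 0" for j
    using coeff[OF that] by (simp add: G_def)
  have "\<forall>z\<in>Z (Suc k). G j z = 0"
    using coefficients_vanish[where n = "Suc s" and f = "f k" and Y = "Z k" and G = G and j = j,
        OF Suc.prems(1)[OF order_refl] Suc.prems(2)[OF lessI] Suc.prems(3)[OF lessI]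
          Suc.prems(4)[OF lessI] Suc.prems(5)[OF lessI] poly G0 sum0 xs(2)] .
  then have "\<forall>z\<in>Z k. G j z = 0" using Suc.prems(2)[of k] by blast
  from coeff[OF this xs(3)] show ?case by (simp add: xs(1))
qed

lemma box_degree_le_list_monomial:
  assumes "finite B" "\<And>i. i < length xs \<Longrightarrow> box_degree_le B D (\<lambda>c. f i (\<phi> c))" "set xs \<subseteq> {..s}"
  shows "box_degree_le B (length xs * D * s) (\<lambda>c. list_monomial f xs (\<phi> c))"
  using assms(2,3)
proof (induction xs)
  case Nil
  then show ?case using box_degree_le_const[OF assms(1)] by simp
next
  case (Cons j xs)
  have "box_degree_le B (j * D + length xs * D * s)
      (\<lambda>c. f (length xs) (\<phi> c) ^ j * list_monomial f xs (\<phi> c))"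
    using Cons by (intro box_degree_le_mult box_degree_le_power assms(1)) auto
  moreover have "j * D + length xs * D * s \<le> length (j # xs) * D * s"
    using Cons.prems(2) by (simp add: algebra_simps)
  ultimately show ?case using box_degree_le_mono[OF assms(1)] by simp
qed

text \<open>Were \<open>k > card B\<close>, there would be more monomials in the pullbacks of \<open>f 0, \<dots>, f (k - 1)\<close>
  with exponents up to \<open>s\<close> than monomials in the parameters that they can involve.\<close>

lemma monomials_on_param_dependent:
  fixes f :: "nat \<Rightarrow> complex^'n^'m \<Rightarrow> complex"
  assumes B: "finite B" "polynomial_param B \<phi>" and "card B < k"
    and f: "\<And>i. i < k \<Longrightarrow> polynomial_fun (f i)"
  shows "\<exists>s c. (\<exists>xs\<in>exponents s k. c xs \<noteq> 0) \<and>
    (\<forall>u. (\<Sum>xs\<in>exponents s k. c xs * list_monomial f xs (\<phi> u)) = 0)"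
proof -
  have "\<forall>i. \<exists>D. i < k \<longrightarrow> box_degree_le B D (\<lambda>c. f i (\<phi> c))"
    using polynomial_fun_param[OF B] f by blast
  then obtain d where d: "\<And>i. i < k \<Longrightarrow> box_degree_le B (d i) (\<lambda>c. f i (\<phi> c))" by metis
  define D where "D = (\<Sum>i<k. d i)"
  have D: "box_degree_le B D (\<lambda>c. f i (\<phi> c))" if "i < k" for i
    using d[OF that] that unfolding D_def
    by (intro box_degree_le_mono[OF B(1) d[OF that]] member_le_sum) auto
  \<comment> \<open>The box has at most
    \<open>((k * D + 1) * (s + 1)) ^ card B = s * (s + 1) ^ card B\<close> elements, fewer than
    \<open>(s + 1) ^ Suc (card B)\<close>, while there are \<open>(s + 1) ^ k\<close> exponent
    lists.\<close>
  define s where "s = (k * D + 1) ^ card B"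
  let ?box = "PiE B (\<lambda>_. {..k * D * s})"
  have "\<forall>xs. \<exists>T. xs \<in> exponents s k \<longrightarrow>
      (\<forall>u. list_monomial f xs (\<phi> u) = (\<Sum>\<beta>\<in>?box. T \<beta> * (\<Prod>b\<in>B. u b ^ \<beta> b)))"
  proof (intro allI)
    fix xs
    have "box_degree_le B (length xs * D * s) (\<lambda>c. list_monomial f xs (\<phi> c))"
      if "xs \<in> exponents s k"
      using that D by (intro box_degree_le_list_monomial B(1)) (auto simp: exponents_def)
    then show "\<exists>T. xs \<in> exponents s k \<longrightarrow>
      (\<forall>u. list_monomial f xs (\<phi> u) = (\<Sum>\<beta>\<in>?box. T \<beta> * (\<Prod>b\<in>B. u b ^ \<beta> b)))"
      unfolding box_degree_le_def by (auto simp: exponents_def)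
  qed
  from choice[OF this] obtain T where T: "\<forall>xs. xs \<in> exponents s k \<longrightarrow>
      (\<forall>u. list_monomial f xs (\<phi> u) = (\<Sum>\<beta>\<in>?box. T xs \<beta> * (\<Prod>b\<in>B. u b ^ \<beta> b)))" ..
  have "card ?box = (k * D * s + 1) ^ card B" using B(1) by (simp add: card_PiE)
  also have "\<dots> \<le> ((k * D + 1) * (s + 1)) ^ card B" by (intro power_mono) auto
  also have "\<dots> = s * (s + 1) ^ card B" unfolding power_mult_distrib by (simp only: s_def)
  also have "\<dots> < (s + 1) ^ Suc (card B)" by simp
  also have "\<dots> \<le> (s + 1) ^ k" using assms(3) by (intro power_increasing) auto
  finally have "card ?box < card (exponents s k)" by (simp add: card_exponents)
  moreover have "finite ?box" using B(1) by (intro finite_PiE) auto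
  ultimately obtain c where c: "\<exists>xs\<in>exponents s k. c xs \<noteq> 0"
    "\<forall>\<beta>\<in>?box. (\<Sum>xs\<in>exponents s k. c xs * T xs \<beta>) = 0"
    using homogeneous_system_nontrivial[OF finite_exponents, of ?box s k T] by metis
  have "(\<Sum>xs\<in>exponents s k. c xs * list_monomial f xs (\<phi> u)) = 0" for u
  proof -
    have "(\<Sum>xs\<in>exponents s k. c xs * list_monomial f xs (\<phi> u)) =
      (\<Sum>xs\<in>exponents s k. \<Sum>\<beta>\<in>?box. c xs * T xs \<beta> * (\<Prod>b\<in>B. u b ^ \<beta> b))"
      by (intro sum.cong refl) (simp add: T sum_distrib_left mult.assoc)
    also have "\<dots> = (\<Sum>\<beta>\<in>?box. (\<Sum>xs\<in>exponents s k. c xs * T xs \<beta>) * (\<Prod>b\<in>B. u b ^ \<beta> b))"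
      by (subst sum.swap) (simp add: sum_distrib_right)
    also have "\<dots> = 0" using c(2) by simp
    finally show ?thesis .
  qed
  with c(1) show ?thesis by metis
qed

text \<open>The largest member of the chain lies in the closure of a single image. If the chain is
  too long, the monomials in polynomials separating consecutive members satisfy a relation on that
  image, hence on its closure, against their independence on the largest member.\<close>

lemma chain_length_le:
  fixes Z :: "nat \<Rightarrow> (complex^'n^'m) set"
  assumes \<Phi>: "finite \<Phi>" "X \<subseteq> (\<Union>\<phi>\<in>\<Phi>. range \<phi>)"
    and B: "\<And>\<phi>. \<phi> \<in> \<Phi> \<Longrightarrow> \<exists>B :: 'b set. finite B \<and> card B \<le> d \<and> polynomial_param B \<phi>"
    and Z: "\<And>i. i \<le> k \<Longrightarrow> irreducible_closed (subtopology zariski X) (Z i)"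
      "\<And>i. i < k \<Longrightarrow> Z i \<subset> Z (Suc i)"
  shows "k \<le> d"
proof (rule ccontr)
  assume "\<not> k \<le> d"
  have ZX: "Z i \<subseteq> X" if "i \<le> k" for i
    using Z(1)[OF that] closedin_subset[of "subtopology zariski X" "Z i"]
    unfolding irreducible_closed_def by auto
  \<comment> \<open>Otherwise each image has a polynomial vanishing on it but not on all of
    \<open>Z k\<close>; the product of these vanishes on \<open>Z k\<close>, which contradicts
    primeness.\<close>
  have "\<exists>\<phi>\<in>\<Phi>. Z k \<subseteq> zero_locus (vanishing_ideal (range \<phi>))"
  proof (rule ccontr)
    assume neg: "\<not> ?thesis"
    have "\<exists>h. h \<in> vanishing_ideal (range \<phi>) \<and> (\<exists>z\<in>Z k. h z \<noteq> 0)" if "\<phi> \<in> \<Phi>" for \<phi>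
    proof -
      have "\<not> Z k \<subseteq> zero_locus (vanishing_ideal (range \<phi>))" using neg that by blast
      then show ?thesis unfolding zero_locus_def by auto
    qed
    then obtain h where h: "\<And>\<phi>. \<phi> \<in> \<Phi> \<Longrightarrow> h \<phi> \<in> vanishing_ideal (range \<phi>)"
      "\<And>\<phi>. \<phi> \<in> \<Phi> \<Longrightarrow> \<exists>z\<in>Z k. h \<phi> z \<noteq> 0" by metis
    have "(\<Prod>\<phi>\<in>\<Phi>. h \<phi> z) = 0" if z: "z \<in> Z k" for z
    proof -
      have "z \<in> (\<Union>\<phi>\<in>\<Phi>. range \<phi>)" using z ZX[of k] \<Phi>(2) by blast
      then obtain \<phi> where \<phi>: "\<phi> \<in> \<Phi>" "z \<in> range \<phi>" by blast
      then have "h \<phi> z = 0" using h(1)[OF \<phi>(1)] by (auto simp: vanishing_ideal_def)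
      then show ?thesis using \<phi>(1) by (intro prod_zero[OF \<Phi>(1)]) blast
    qed
    moreover have "polynomial_fun (h \<phi>)" if "\<phi> \<in> \<Phi>" for \<phi>
      using h(1)[OF that] by (simp add: vanishing_ideal_def)
    ultimately obtain \<phi> where "\<phi> \<in> \<Phi>" "\<forall>z\<in>Z k. h \<phi> z = 0"
      using irreducible_closed_prime_prod[OF Z(1)[OF order_refl] \<Phi>(1), of h] by metis
    then show False using h(2) by metis
  qed
  then obtain \<phi> where \<phi>: "\<phi> \<in> \<Phi>" "Z k \<subseteq> zero_locus (vanishing_ideal (range \<phi>))" by metis
  have "\<exists>f. i < k \<longrightarrow> polynomial_fun f \<and> (\<forall>z\<in>Z i. f z = 0) \<and> (\<exists>z\<in>Z (Suc i). f z \<noteq> 0)" for i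
  proof (cases "i < k")
    case True
    then obtain z where z: "z \<in> Z (Suc i)" "z \<notin> Z i" using Z(2) by blast
    have "closedin (subtopology zariski X) (Z i)"
      using Z(1)[of i] True unfolding irreducible_closed_def by simp
    then obtain P where P: "P \<subseteq> Collect polynomial_fun" "Z i = X \<inter> zero_locus P"
      unfolding closedin_subtopology_zariski by metis
    moreover have "z \<in> X" using z(1) ZX[of "Suc i"] True by auto
    ultimately obtain f where f: "f \<in> P" "f z \<noteq> 0" using z(2) unfolding zero_locus_def by auto
    have "polynomial_fun f" using P(1) f(1) by auto
    moreover have "\<forall>z\<in>Z i. f z = 0" unfolding P(2) using zero_locusD[OF _ f(1)] by simp
    ultimately show ?thesis using z(1) f(2) by metis
  qed simp
  then obtain f where f: "\<And>i. i < k \<Longrightarrow> polynomial_fun (f i)"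
    "\<And>i z. i < k \<Longrightarrow> z \<in> Z i \<Longrightarrow> f i z = 0" "\<And>i. i < k \<Longrightarrow> \<exists>z\<in>Z (Suc i). f i z \<noteq> 0"
    by metis
  obtain B :: "'b set" where B': "finite B" "card B < k" "polynomial_param B \<phi>"
    using B[OF \<phi>(1)] \<open>\<not> k \<le> d\<close> by force
  then obtain s c where c: "\<exists>xs\<in>exponents s k. c xs \<noteq> 0"
    "\<And>u. (\<Sum>xs\<in>exponents s k. c xs * list_monomial f xs (\<phi> u)) = 0"
    using monomials_on_param_dependent[OF B'(1,3,2), of f, OF f(1)] by metis
  have "polynomial_fun (\<lambda>z. \<Sum>xs\<in>exponents s k. c xs * list_monomial f xs z)"
    using f(1) by (intro polynomial_fun_sum polynomial_fun.mult polynomial_fun.const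
        polynomial_fun_list_monomial) (auto simp: exponents_def)
  then have "(\<lambda>z. \<Sum>xs\<in>exponents s k. c xs * list_monomial f xs z) \<in> vanishing_ideal (range \<phi>)"
    using c(2) by (simp add: vanishing_ideal_def)
  then have "(\<Sum>xs\<in>exponents s k. c xs * list_monomial f xs z) = 0" if "z \<in> Z k" for z
    using zero_locusD \<phi>(2) that by blast
  from chain_monomials_independent[where f = f and Z = Z and c = c,
      OF Z(1) psubset_imp_subset[OF Z(2)] f this]
  show False using c(1) by metis
qed

subsection \<open>Symmetric determinantal varieties\<close>

text \<open>The set \<open>{a, i}\<close> determines \<open>a\<close> and \<open>i\<close> up to
  order, and both orders qualify only if \<open>a\<close> is in \<open>I\<close> too; the symmetry
  hypothesis covers just this case.\<close>

lemma exists_on_pairs: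
  assumes "\<And>i j. i \<in> I \<Longrightarrow> j \<in> I \<Longrightarrow> F i j = F j i"
  shows "\<exists>c. \<forall>a. \<forall>i\<in>I. c {a, i} = F a i"
proof -
  define c where "c b = (SOME z. \<exists>a i. b = {a, i} \<and> i \<in> I \<and> z = F a i)" for b
  have "c {a, i} = F a i" if "i \<in> I" for a i
  proof -
    have "\<exists>a' i'. {a, i} = {a', i'} \<and> i' \<in> I \<and> c {a, i} = F a' i'"
      unfolding c_def by (rule someI_ex) (use that in blast)
    then obtain a' i' where "{a, i} = {a', i'}" "i' \<in> I" "c {a, i} = F a' i'" by blast
    then show ?thesis using assms that by (auto simp: doubleton_eq_iff)
  qed
  then show ?thesis by blast
qed

text \<open>The matrix \<open>W S W\<^sup>T\<close> where \<open>S\<close> is symmetric with index set \<open>I\<close> and the rows of \<open>W\<close>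
  with index in \<open>I\<close> form the identity. The parameter at \<open>{a, i}\<close> is an entry of \<open>S\<close> if
  both indices are in \<open>I\<close>, and an entry of \<open>W\<close> if only one is.\<close>

definition sym_chart_factor :: "'n set \<Rightarrow> ('n set \<Rightarrow> complex) \<Rightarrow> 'n \<Rightarrow> 'n \<Rightarrow> complex" where
  "sym_chart_factor I c a i = (if a \<in> I then of_bool (a = i) else c {a, i})"

definition sym_chart :: "'n set \<Rightarrow> ('n set \<Rightarrow> complex) \<Rightarrow> complex^'n^'n" where
  "sym_chart I c = (\<chi> a b. \<Sum>i\<in>I. \<Sum>j\<in>I.
     sym_chart_factor I c a i * (c {i, j} * sym_chart_factor I c b j))"

lemma transpose_sym_chart: "transpose (sym_chart I c) = sym_chart I c"
proof -
  have "(\<Sum>i\<in>I. \<Sum>j\<in>I. sym_chart_factor I c b i * (c {i, j} * sym_chart_factor I c a j)) =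
    (\<Sum>i\<in>I. \<Sum>j\<in>I. sym_chart_factor I c a i * (c {i, j} * sym_chart_factor I c b j))" for a b
    by (subst sum.swap) (simp add: insert_commute ac_simps)
  then show ?thesis by (simp add: sym_chart_def transpose_def vec_eq_iff)
qed

lemma rank_sym_chart: "rank (sym_chart I c) \<le> card I"
  by (rule rank_le_card_if_rows_spanned[where w = "sym_chart_factor I c"
        and u = "\<lambda>i. \<chi> b. \<Sum>j\<in>I. c {i, j} * sym_chart_factor I c b j"])
    (simp_all add: vec_eq_iff row_def sym_chart_def sum_distrib_left)

text \<open>Spanning rows give \<open>A = W A_I\<close>, where \<open>A_I\<close> consists of the
  rows with index in \<open>I\<close>; by symmetry \<open>A_I = S W\<^sup>T\<close>, where
  \<open>S\<close> is the block of \<open>A\<close> on \<open>I\<close>.\<close>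

lemma sym_chart_surj:
  fixes A :: "complex^'n^'n"
  assumes "transpose A = A"
  shows "\<exists>I c. card I \<le> rank A \<and> A = sym_chart I c"
proof -
  obtain I where I: "card I \<le> rank A" "\<forall>j. \<exists>w. \<forall>k. A $ j $ k = (\<Sum>i\<in>I. w i * A $ i $ k)"
    using rows_spanned_by_few by metis
  from choice[OF I(2)] obtain w where w: "\<forall>j k. A $ j $ k = (\<Sum>i\<in>I. w j i * A $ i $ k)" ..
  have sym: "A $ i $ j = A $ j $ i" for i j
    using assms by (metis transpose_def vec_lambda_beta)
  obtain c where c: "\<forall>a. \<forall>i\<in>I. c {a, i} = (if a \<in> I then A $ a $ i else w a i)"
    using exists_on_pairs[of I "\<lambda>a i. if a \<in> I then A $ a $ i else w a i"] sym by auto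
  have W: "A $ a $ k = (\<Sum>i\<in>I. sym_chart_factor I c a i * A $ i $ k)" for a k
  proof (cases "a \<in> I")
    case True
    then show ?thesis by (simp add: sym_chart_factor_def of_bool_def if_distrib[of "\<lambda>x. x * _"] sum.delta cong: if_cong)
  next
    case False
    have "A $ a $ k = (\<Sum>i\<in>I. w a i * A $ i $ k)" using w by blast
    also have "\<dots> = (\<Sum>i\<in>I. sym_chart_factor I c a i * A $ i $ k)"
      by (rule sum.cong) (use False c in \<open>auto simp: sym_chart_factor_def\<close>)
    finally show ?thesis .
  qed
  have "A $ a $ b = sym_chart I c $ a $ b" for a b
  proof -
    have "A $ i $ b = (\<Sum>j\<in>I. c {i, j} * sym_chart_factor I c b j)" if "i \<in> I" for i
      unfolding sym[of i b] W[of b i] by (rule sum.cong) (use c that sym in auto)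
    then show ?thesis
      unfolding W[of a b] by (simp add: sym_chart_def sum_distrib_left)
  qed
  then have "A = sym_chart I c" by (simp add: vec_eq_iff)
  with I(1) show ?thesis by metis
qed

lemma sym_chart_row_inside:
  assumes "i \<in> I"
  shows "sym_chart I c $ i $ b = (\<Sum>j\<in>I. c {i, j} * sym_chart_factor I c b j)"
proof -
  have "sym_chart I c $ i $ b =
      (\<Sum>k\<in>I. sym_chart_factor I c i k * (\<Sum>j\<in>I. c {k, j} * sym_chart_factor I c b j))"
    by (simp add: sym_chart_def sum_distrib_left)
  also have "\<dots> = (\<Sum>k\<in>I. if i = k then (\<Sum>j\<in>I. c {i, j} * sym_chart_factor I c b j) else 0)"
    using assms by (intro sum.cong refl) (simp add: sym_chart_factor_def)
  finally show ?thesis using assms by simp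
qed

lemma sym_chart_entry_inside:
  assumes "i \<in> I" "j \<in> I"
  shows "sym_chart I c $ i $ j = c {i, j}"
proof -
  have "sym_chart I c $ i $ j = (\<Sum>k\<in>I. if j = k then c {i, j} else 0)"
    unfolding sym_chart_row_inside[OF assms(1)]
    using assms(2) by (intro sum.cong refl) (simp add: sym_chart_factor_def)
  then show ?thesis using assms(2) by simp
qed

text \<open>If row \<open>i\<close> of \<open>S\<close> is a unit vector, then row \<open>i\<close>
  of \<open>S W\<^sup>T\<close> is a row of \<open>W\<^sup>T\<close>, whose entries outside
  \<open>I\<close> are parameters.\<close>

lemma sym_chart_entry_across:
  assumes "i \<in> I" "a \<notin> I" "\<And>j. j \<in> I \<Longrightarrow> c {i, j} = of_bool (i = j)"
  shows "sym_chart I c $ i $ a = c {i, a}"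
proof -
  have "sym_chart I c $ i $ a = (\<Sum>j\<in>I. if i = j then c {a, i} else 0)"
    unfolding sym_chart_row_inside[OF assms(1)]
    using assms(2,3) by (intro sum.cong refl) (simp add: sym_chart_factor_def)
  then show ?thesis using assms(1) by (simp add: insert_commute)
qed

lemma polynomial_param_sym_chart:
  "polynomial_param (pairs_touching I) (sym_chart I :: _ \<Rightarrow> complex^'n^'n)"
proof -
  have mem: "{a, i} \<in> pairs_touching I" if "i \<in> I" for a i
    using that by (auto simp: pairs_touching_def insert_commute)
  have "box_degree_le (pairs_touching I) 1 (\<lambda>c. sym_chart_factor I c a i)" if "i \<in> I" for a i :: 'n
  proof (cases "a \<in> I")
    case True
    then show ?thesis
      unfolding sym_chart_factor_def by (simp only: if_True box_degree_le_const finite)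
  next
    case False
    then show ?thesis
      unfolding sym_chart_factor_def
      by (simp only: if_False box_degree_le_var[OF finite_pairs_touching mem[OF that]])
  qed
  then have "box_degree_le (pairs_touching I) (1 + (1 + 1)) (\<lambda>c. sym_chart I c $ a $ b)" for a b :: 'n
    unfolding sym_chart_def vec_lambda_beta
    by (intro box_degree_le_sum box_degree_le_mult box_degree_le_var finite_pairs_touching mem)
  then show ?thesis unfolding polynomial_param_def by blast
qed

text \<open>The irreducible closed sets are the closures of the images of the coordinate subspaces on
  which all but the first \<open>i\<close> parameters have the values of the chart at \<open>S = 1\<close>, \<open>W = 0\<close>.
  The entries of \<open>S\<close> come last: while \<open>S = 1\<close>, the parameters are entries of the matrix.\<close>

lemma sym_chart_chain:
  fixes I :: "'n::finite set" and X :: "(complex^'n^'n) set"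
  assumes X: "range (sym_chart I) \<subseteq> X"
  shows "\<exists>Z. (\<forall>i\<le>card (pairs_touching I). irreducible_closed (subtopology zariski X) (Z i)) \<and>
    (\<forall>i<card (pairs_touching I). Z i \<subset> Z (Suc i))"
proof -
  let ?in = "{b \<in> pairs_touching I. b \<subseteq> I}" and ?across = "{b \<in> pairs_touching I. \<not> b \<subseteq> I}"
  obtain l1 l2 where l: "set l1 = ?across" "distinct l1" "set l2 = ?in" "distinct l2"
    using finite_distinct_list[OF finite[of ?across]] finite_distinct_list[OF finite[of ?in]] by metis
  define l where "l = l1 @ l2"
  have "distinct l" and set_l: "set l = pairs_touching I" using l by (auto simp: l_def)
  then have len: "length l = card (pairs_touching I)" by (simp flip: distinct_card)
  \<comment> \<open>Here \<open>S\<close> is the identity and \<open>W\<close> is zero: the value is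
    1 exactly at the singletons.\<close>
  define base :: "'n set \<Rightarrow> complex" where "base b = of_bool (card b = 1)" for b
  define E where "E i = {c. \<forall>b\<in>set (drop i l). c b = base b}" for i
  define Z where "Z i = X \<inter> zero_locus (vanishing_ideal (sym_chart I ` E i))" for i
  have base_E: "base \<in> E i" for i by (simp add: E_def)
  have "irreducible_closed (subtopology zariski X) (Z i)" for i
    unfolding Z_def
  proof (rule irreducible_closed_param[OF finite_pairs_touching polynomial_param_sym_chart])
    show "E i \<noteq> {}" using base_E by auto
    show "(\<lambda>b. c b + t * (c' b - c b)) \<in> E i" if "c \<in> E i" "c' \<in> E i" for c c' t
      using that by (simp add: E_def)
    show "sym_chart I ` E i \<subseteq> X" using X by auto
  qed
  moreover have "Z i \<subset> Z (Suc i)" if i: "i < card (pairs_touching I)" for i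
  proof
    have drop_i: "set (drop i l) = insert (l ! i) (set (drop (Suc i) l))"
      using i by (simp add: len flip: Cons_nth_drop_Suc)
    then have "E i \<subseteq> E (Suc i)" by (auto simp: E_def)
    then show "Z i \<subseteq> Z (Suc i)" unfolding Z_def
      by (intro Int_mono zero_locus_antimono vanishing_ideal_antimono image_mono order_refl)
    have "l ! i \<in> pairs_touching I" using i set_l len nth_mem by metis
    then obtain p q where pq: "l ! i = {p, q}" "p \<in> I" by (auto simp: pairs_touching_def)
    have entry: "sym_chart I c $ p $ q = c (l ! i)" if c: "c \<in> E (Suc i)" for c
    proof (cases "q \<in> I")
      case True
      then show ?thesis using pq by (simp add: sym_chart_entry_inside)
    next
      case False
      \<comment> \<open>A parameter of \<open>W\<close> belongs to \<open>l1\<close>, so it is freed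
        while all entries of \<open>S\<close> still have their base values.\<close>
      have "i < length l1"
      proof (rule ccontr)
        assume "\<not> i < length l1"
        then have "l ! i \<in> set l2" using i len by (simp add: l_def nth_append)
        then show False using False pq(1) l(3) by simp
      qed
      then have "set l2 \<subseteq> set (drop (Suc i) l)" by (simp add: l_def)
      then have "c b = base b" if "b \<in> ?in" for b using c l(3) that by (auto simp: E_def)
      moreover have "{p, j} \<in> ?in" if "j \<in> I" for j
        using that pq(2) by (auto simp: pairs_touching_def)
      ultimately have "c {p, j} = of_bool (p = j)" if "j \<in> I" for j
        using that by (simp add: base_def card_insert_if)
      then show ?thesis using sym_chart_entry_across[OF pq(2) False] pq(1) by simp
    qed
    let ?h = "\<lambda>A :: complex^'n^'n. A $ p $ q + - base (l ! i)"
    have h: "polynomial_fun ?h" by (intro polynomial_fun.intros)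
    have "?h (sym_chart I c) = 0" if "c \<in> E i" for c
      using entry[of c] that \<open>E i \<subseteq> E (Suc i)\<close> drop_i by (auto simp: E_def)
    with h have "?h \<in> vanishing_ideal (sym_chart I ` E i)"
      by (simp add: vanishing_ideal_def)
    then have Zi: "?h A = 0" if "A \<in> Z i" for A
      using that zero_locusD unfolding Z_def by blast
    \<comment> \<open>Differs from the base point only in the parameter freed in this step, which
      gives the separating polynomial the value 1.\<close>
    let ?c = "base(l ! i := base (l ! i) + 1)"
    have "l ! i \<notin> set (drop (Suc i) l)"
      using \<open>distinct l\<close> i by (simp add: len distinct_conv_nth in_set_conv_nth) 
    then have c: "?c \<in> E (Suc i)" by (auto simp: E_def)
    then have "sym_chart I ?c \<in> Z (Suc i)"
      using X subset_zero_locus_vanishing_ideal[of "sym_chart I ` E (Suc i)"] unfolding Z_def by blast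
    moreover have "?h (sym_chart I ?c) \<noteq> 0" using entry[OF c] by simp
    ultimately show "Z i \<noteq> Z (Suc i)" using Zi by metis
  qed
  ultimately show ?thesis by blast
qed

text \<open>The charts with \<open>card I \<le> r\<close> cover the variety and have at most the
  claimed number of parameters; one chart with \<open>card I = min r CARD('n)\<close> already
  carries a chain of that length.\<close>

lemma krull_dim_sym_rank_le:
  "krull_dim (subtopology zariski {A :: complex^'n^'n. transpose A = A \<and> rank A \<le> r})
   = enat ((CARD('n) + 1 choose 2) - (CARD('n) + 1 - r choose 2))" (is "krull_dim ?X = enat ?d")
proof (rule antisym)
  let ?S = "{A :: complex^'n^'n. transpose A = A \<and> rank A \<le> r}"
  let ?\<Phi> = "sym_chart ` {I :: 'n set. card I \<le> r}"
  have "?S \<subseteq> (\<Union>\<phi>\<in>?\<Phi>. range \<phi>)"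
  proof
    fix A assume A: "A \<in> ?S"
    then obtain I c where "card I \<le> rank A" "A = sym_chart I c" using sym_chart_surj[of A] by blast
    moreover from this have "card I \<le> r" using A by simp
    ultimately show "A \<in> (\<Union>\<phi>\<in>?\<Phi>. range \<phi>)" by blast
  qed
  moreover have "\<exists>B :: 'n set set. finite B \<and> card B \<le> ?d \<and> polynomial_param B \<phi>" if \<phi>: "\<phi> \<in> ?\<Phi>" for \<phi>
  proof -
    obtain I :: "'n set" where I: "\<phi> = sym_chart I" "I \<in> {I. card I \<le> r}"
      using \<phi> by (rule imageE)
    then show ?thesis unfolding I(1)
      using card_pairs_touching_le[of I r] polynomial_param_sym_chart[of I] finite_pairs_touching[of I]
      by blast
  qed
  ultimately have le: "k \<le> ?d" if "\<forall>i\<le>k. irreducible_closed ?X (Z i)" "\<forall>i<k. Z i \<subset> Z (Suc i)" for k Z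
    using chain_length_le[of ?\<Phi> ?S ?d k Z] that by simp
  show "krull_dim ?X \<le> enat ?d"
    unfolding krull_dim_def by (rule Sup_least) (use le in auto)
  have "min r CARD('n) \<le> CARD('n)" by simp
  then obtain I :: "'n set" where I: "card I = min r CARD('n)"
    by (metis obtain_subset_with_card_n)
  have "range (sym_chart I) \<subseteq> ?S"
    using rank_sym_chart[of I] I by (auto simp: transpose_sym_chart intro: order_trans)
  from sym_chart_chain[OF this] show "enat ?d \<le> krull_dim ?X"
    unfolding krull_dim_def card_pairs_touching_min[OF I] by (intro Sup_upper) blast
qed

subsection \<open>Polyhedral cones\<close>

text \<open>Cutting the cone with a cube around the origin gives a polytope, and every point of the
  cone can be scaled into the cube.\<close>

lemma polyhedral_cone_eq_hull_polytope:
  fixes P :: "'a::euclidean_space set"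
  assumes "polyhedral_cone P"
  shows "\<exists>Q. polytope Q \<and> P = convex_cone hull Q"
proof (intro exI conjI)
  let ?Q = "cbox (- One) One \<inter> P"
  show "polytope ?Q"
    using assms unfolding polyhedral_cone_def
    by (intro polytope_Int_polyhedron polytope_interval) simp
  have P: "convex_cone P" using assms by (simp add: polyhedral_cone_def)
  show "P = convex_cone hull ?Q"
  proof
    show "convex_cone hull ?Q \<subseteq> P" using P by (intro hull_minimal) auto
    show "P \<subseteq> convex_cone hull ?Q"
    proof
      fix x assume x: "x \<in> P"
      let ?c = "norm x + 1"
      let ?y = "inverse ?c *\<^sub>R x"
      have pos: "?c > 0" using norm_ge_zero[of x] by linarith
      have "\<bar>?y \<bullet> b\<bar> \<le> 1" if "b \<in> Basis" for b
      proof -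
        have "\<bar>x \<bullet> b\<bar> \<le> ?c" using Basis_le_norm[OF that, of x] by simp
        then show ?thesis using pos by (simp add: abs_mult divide_simps)
      qed
      then have "?y \<in> cbox (- One) One" by (auto simp: mem_box abs_le_iff)
      moreover have "?y \<in> P" using convex_cone_scaleR[OF P _ x] by simp
      ultimately have "?c *\<^sub>R ?y \<in> convex_cone hull ?Q"
        by (intro convex_cone_hull_mul hull_inc) auto
      then show "x \<in> convex_cone hull ?Q" using pos by simp
    qed
  qed
qed

text \<open>A generating polytope is mapped to a polytope, and convex conic hulls commute with
  linear maps.\<close>

lemma polyhedral_cone_linear_image:
  fixes f :: "'a::euclidean_space \<Rightarrow> 'b::euclidean_space"
  assumes "polyhedral_cone P" "linear f"
  shows "polyhedral_cone (f ` P)"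
proof -
  obtain Q where Q: "polytope Q" "P = convex_cone hull Q"
    using polyhedral_cone_eq_hull_polytope[OF assms(1)] by blast
  then have "f ` P = convex_cone hull (f ` Q)"
    using convex_cone_hull_linear_image[OF assms(2)] by simp
  moreover have "polytope (f ` Q)" using polytope_linear_image[OF assms(2) Q(1)] .
  ultimately show ?thesis
    by (simp add: polyhedral_cone_def polyhedron_convex_cone_hull_polytope convex_cone_convex_cone_hull)
qed

lemma polyhedral_cone_le:
  fixes f :: "'i::finite \<Rightarrow> 'a::euclidean_space \<Rightarrow> real"
  assumes "\<And>i. linear (f i)"
  shows "polyhedral_cone {x. \<forall>i. f i x \<le> 0}"
proof -
  have f: "f i x = adjoint (f i) 1 \<bullet> x" for i x
    using adjoint_works[OF assms[of i], of x 1] by (simp add: inner_commute)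
  have "{x. \<forall>i. f i x \<le> 0} = (\<Inter>i. {x. adjoint (f i) 1 \<bullet> x \<le> 0})" by (auto simp: f)
  moreover have "polyhedron \<dots>" by (intro polyhedron_Inter) (auto simp: polyhedron_halfspace_le)
  moreover have "convex_cone (\<Inter>i. {x. adjoint (f i) 1 \<bullet> x \<le> 0})"
    by (intro convex_cone_Inter) (auto simp: convex_cone_halfspace_le)
  ultimately show ?thesis by (simp add: polyhedral_cone_def)
qed

section \<open>Dimension of finite unions of cones\<close>

text \<open>Take \<open>x\<close> outside the subspaces of \<open>G\<close>, hence in
  \<open>D\<close>, and \<open>y\<close> outside \<open>D\<close>. Apart from \<open>x\<close>, the
  segment avoids \<open>D\<close>, so two of its points share a subspace of \<open>G\<close>, which
  then contains the whole line and with it \<open>x\<close>.\<close>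

lemma convex_subset_finite_Union_subspaces:
  fixes K :: "'a::real_vector set"
  assumes "finite G" "\<And>D. D \<in> G \<Longrightarrow> subspace D" "convex K" "K \<noteq> {}" "K \<subseteq> \<Union>G"
  shows "\<exists>D\<in>G. K \<subseteq> D"
  using assms(1,2,5)
proof (induction G rule: finite_induct)
  case empty
  then show ?case using assms(4) by simp
next
  case (insert D G)
  show ?case
  proof (rule ccontr)
    assume neg: "\<not> ?case"
    then have "\<not> K \<subseteq> \<Union>G" using insert by blast
    then obtain x where x: "x \<in> K" "x \<notin> \<Union>G" by blast
    then have xD: "x \<in> D" using insert.prems(2) by blast
    obtain y where y: "y \<in> K" "y \<notin> D" using neg by blast
    let ?l = "\<lambda>t::real. x + t *\<^sub>R (y - x)"
    have D: "subspace D" using insert.prems(1) by simp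
    have "?l t \<in> \<Union>G" if t: "t \<in> {0<..1}" for t
    proof -
      have "?l t = (1 - t) *\<^sub>R x + t *\<^sub>R y" by (simp add: algebra_simps)
      then have "?l t \<in> K" using convexD[OF assms(3) x(1) y(1), of "1 - t" t] t by simp
      moreover have "?l t \<notin> D"
      proof
        assume "?l t \<in> D"
        from subspace_add[OF D subspace_scale[OF D subspace_diff[OF D this xD], of "inverse t"] xD]
        show False using y(2) t by simp
      qed
      ultimately show ?thesis using insert.prems(2) by blast
    qed
    then have "\<forall>t\<in>{0<..1}. \<exists>C. C \<in> G \<and> ?l t \<in> C" by blast
    then obtain C where C: "\<forall>t\<in>{0<..1}. C t \<in> G \<and> ?l t \<in> C t" by (rule bchoice[THEN exE])
    have "infinite {0<..1::real}" by simp
    moreover have "finite (C ` {0<..1})"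
      using C insert.hyps(1) by (intro finite_subset[of "C ` {0<..1}" G]) auto
    ultimately obtain t where t: "t \<in> {0<..1}" "infinite {s \<in> {0<..1}. C s = C t}"
      using pigeonhole_infinite by blast
    have "\<not> {s \<in> {0<..1}. C s = C t} \<subseteq> {t}"
      using t(2) finite_subset by blast
    then obtain s where s: "s \<in> {0<..1}" "C s = C t" "s \<noteq> t" by blast
    have ls: "?l s \<in> C t" "?l t \<in> C t" "subspace (C t)" "C t \<in> G"
      using C s(1,2) t(1) insert.prems(1) by auto
    have "x = ?l s - (s / (s - t)) *\<^sub>R (?l s - ?l t)"
    proof -
      have "?l s - ?l t = (s - t) *\<^sub>R (y - x)" by (simp add: algebra_simps)
      then show ?thesis using s(3) by simp
    qed
    also have "\<dots> \<in> C t" using ls(1-3) by (intro subspace_diff subspace_scale)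
    finally show False using x(2) ls(4) by blast
  qed
qed

text \<open>One decomposition bounds all others from above: a convex cone in \<open>S\<close> is
  covered by the finitely many spans of members of \<open>F\<close>, hence lies in one of
  them.\<close>

lemma has_conical_dimI:
  assumes F: "cone_decomposition F S" "\<And>C. C \<in> F \<Longrightarrow> dim C \<le> d"
    and lower: "\<And>G. cone_decomposition G S \<Longrightarrow> \<exists>C\<in>G. d \<le> dim C"
  shows "has_conical_dim S d"
  unfolding has_conical_dim_def
proof (intro conjI exI allI impI)
  show "cone_decomposition F S" by fact
  fix G assume G: "cone_decomposition G S"
  have le: "dim C \<le> d" if C: "C \<in> G" for C
  proof -
    have "convex C" "C \<noteq> {}"
      using G C unfolding cone_decomposition_def polyhedral_cone_def convex_cone_def by auto
    moreover have "C \<subseteq> \<Union>(span ` F)"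
    proof
      fix x assume "x \<in> C"
      then have "x \<in> \<Union>F" using G F(1) C unfolding cone_decomposition_def by blast
      then show "x \<in> \<Union>(span ` F)" by (auto intro: span_base)
    qed
    moreover have "finite (span ` F)" using F(1) unfolding cone_decomposition_def by simp
    ultimately obtain D where "D \<in> F" "C \<subseteq> span D"
      using convex_subset_finite_Union_subspaces[of "span ` F" C] by auto
    then show ?thesis using F(2)[of D] dim_subset[of C "span D"] by simp
  qed
  obtain C where C: "C \<in> G" "d \<le> dim C" using lower[OF G] by blast
  then have "dim C = d" using le[OF C(1)] by simp
  have "finite (dim ` G)" using G unfolding cone_decomposition_def by simp
  then show "Max (dim ` G) = d"
    by (rule Max_eqI) (use le C(1) \<open>dim C = d\<close> in auto)
qed

text \<open>Serves to bound the dimension after projecting to entries that can be prescribed freely.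
  The image of \<open>K\<close> is convex, so the span of the image of a single cone contains it,
  and with it the scaled differences in \<open>E\<close>.\<close>

lemma conical_dim_lower_bound:
  fixes \<pi> :: "'a::euclidean_space \<Rightarrow> 'b::euclidean_space"
  assumes F: "cone_decomposition F S" and \<pi>: "linear \<pi>"
    and K: "convex K" "K \<noteq> {}" "\<pi> ` K \<subseteq> \<pi> ` S"
    and E: "independent E" "\<And>e. e \<in> E \<Longrightarrow> \<exists>x\<in>K. \<exists>y\<in>K. \<exists>t. e = t *\<^sub>R (\<pi> x - \<pi> y)"
  shows "\<exists>C\<in>F. card E \<le> dim C"
proof -
  have "\<pi> ` K \<subseteq> \<Union>((\<lambda>C. span (\<pi> ` C)) ` F)"
  proof
    fix y assume "y \<in> \<pi> ` K"
    then obtain C x where "C \<in> F" "x \<in> C" "y = \<pi> x"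
      using K(3) F unfolding cone_decomposition_def by blast
    then show "y \<in> \<Union>((\<lambda>C. span (\<pi> ` C)) ` F)" by (auto intro: span_base)
  qed
  moreover have "finite ((\<lambda>C. span (\<pi> ` C)) ` F)" using F unfolding cone_decomposition_def by simp
  moreover have "convex (\<pi> ` K)" using convex_linear_image[OF \<pi> K(1)] .
  ultimately obtain C where C: "C \<in> F" "\<pi> ` K \<subseteq> span (\<pi> ` C)"
    using convex_subset_finite_Union_subspaces[of "(\<lambda>C. span (\<pi> ` C)) ` F" "\<pi> ` K"] K(2)
    by (metis (no_types, lifting) imageE image_is_empty subspace_span)
  have "E \<subseteq> span (\<pi> ` C)"
  proof
    fix e assume "e \<in> E"
    then obtain x y t where "x \<in> K" "y \<in> K" "e = t *\<^sub>R (\<pi> x - \<pi> y)" using E(2) by blast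
    moreover from this have "\<pi> x \<in> span (\<pi> ` C)" "\<pi> y \<in> span (\<pi> ` C)" using C(2) by blast+
    ultimately show "e \<in> span (\<pi> ` C)" by (simp only: span_scale span_diff)
  qed
  then have "card E \<le> dim (\<pi> ` C)" using independent_card_le_dim[OF _ E(1), of "span (\<pi> ` C)"]
    by (simp only: dim_span)
  also have "\<dots> \<le> dim C" using dim_image_le[OF \<pi>] .
  finally show ?thesis using C(1) by blast
qed

text \<open>The point behaves like one in the relative interior. It is a sum of points at which
  individual functionals are positive; nothing cancels, as all values are nonnegative.\<close>

lemma convex_cone_generic_point:
  fixes P :: "'a::real_vector set"
  assumes P: "convex_cone P" and "finite A"
    and g: "\<And>a. a \<in> A \<Longrightarrow> linear (g a)" "\<And>a x. a \<in> A \<Longrightarrow> x \<in> P \<Longrightarrow> (0::real) \<le> g a x"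
  shows "\<exists>v\<in>P. \<forall>a\<in>A. g a v = 0 \<longrightarrow> (\<forall>x\<in>P. g a x = 0)"
  using \<open>finite A\<close> g
proof (induction A rule: finite_induct)
  case empty
  then show ?case using convex_cone_contains_0[OF P] by blast
next
  case (insert a A)
  from insert.IH[OF insert.prems(1)[OF insertI2] insert.prems(2)[OF insertI2]]
  obtain v where v: "v \<in> P" "\<forall>a\<in>A. g a v = 0 \<longrightarrow> (\<forall>x\<in>P. g a x = 0)" by blast
  show ?case
  proof (cases "\<forall>x\<in>P. g a x = 0")
    case True
    then show ?thesis using v by auto
  next
    case False
    then obtain x where x: "x \<in> P" "g a x \<noteq> 0" by blast
    have vx: "v + x \<in> P" using convex_cone_add[OF P v(1) x(1)] .
    have split: "g b v = 0 \<and> g b x = 0" if "b \<in> insert a A" "g b (v + x) = 0" for b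
      using that insert.prems(2)[OF that(1) v(1)] insert.prems(2)[OF that(1) x(1)]
        linear_add[OF insert.prems(1)[OF that(1)], of v x] by linarith
    show ?thesis
    proof (intro bexI[OF _ vx] ballI impI)
      fix b y assume b: "b \<in> insert a A" "g b (v + x) = 0" and y: "y \<in> P"
      then have "b \<noteq> a" using split[OF b] x(2) by blast
      then show "g b y = 0" using split[OF b] v(2) b(1) y by blast
    qed
  qed
qed

text \<open>Linear independence survives small perturbations: apply the dual basis to a relation and
  look at its largest coefficient.\<close>

lemma independent_limit:
  fixes X :: "nat \<Rightarrow> 'a::euclidean_space \<Rightarrow> 'a"
  assumes B: "independent B" and X: "\<And>b. b \<in> B \<Longrightarrow> (\<lambda>n. X n b) \<longlonglongrightarrow> b"
  shows "\<forall>\<^sub>F n in sequentially. \<forall>c. (\<Sum>b\<in>B. c b *\<^sub>R X n b) = 0 \<longrightarrow> (\<forall>b\<in>B. c b = 0)"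
proof -
  have fin: "finite B" using B independent_imp_finite by blast
  have "\<forall>b. \<exists>g. linear g \<and> (\<forall>b'\<in>B. g b' = (of_bool (b' = b) :: real))"
    by (rule allI, rule linear_independent_extend[OF B])
  from choice[OF this] obtain g where
    g': "\<forall>b. linear (g b) \<and> (\<forall>b'\<in>B. g b b' = (of_bool (b' = b) :: real))" ..
  then have g: "linear (g b)" and g_eq: "b' \<in> B \<Longrightarrow> g b b' = of_bool (b' = b)" for b b' by simp_all
  \<comment> \<open>Makes \<open>card B * \<epsilon> < 1\<close>, so the errors, each at most
    \<open>\<epsilon>\<close> times the largest coefficient, cannot cancel that coefficient.\<close>
  define \<epsilon> where "\<epsilon> = 1 / (2 * (real (card B) + 1))"
  have "\<epsilon> > 0" by (simp add: \<epsilon>_def)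
  have "\<forall>\<^sub>F n in sequentially. \<forall>b\<in>B. \<forall>b'\<in>B. \<bar>g b (X n b') - of_bool (b' = b)\<bar> < \<epsilon>"
  proof (intro eventually_ball_finite fin ballI)
    fix b b' assume b: "b \<in> B" "b' \<in> B"
    have "bounded_linear (g b)" using g by (simp add: linear_conv_bounded_linear)
    from bounded_linear.tendsto[OF this X[OF b(2)]]
    have "(\<lambda>n. g b (X n b')) \<longlonglongrightarrow> of_bool (b' = b)" unfolding g_eq[OF b(2)] .
    from tendstoD[OF this \<open>\<epsilon> > 0\<close>]
    show "\<forall>\<^sub>F n in sequentially. \<bar>g b (X n b') - of_bool (b' = b)\<bar> < \<epsilon>"
      unfolding dist_real_def .
  qed
  then show ?thesis
  proof (rule eventually_mono, intro allI impI)
    fix n c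
    assume near: "\<forall>b\<in>B. \<forall>b'\<in>B. \<bar>g b (X n b') - of_bool (b' = b)\<bar> < \<epsilon>"
      and zero: "(\<Sum>b\<in>B. c b *\<^sub>R X n b) = 0"
    show "\<forall>b\<in>B. c b = 0"
    proof (cases "B = {}")
      case False
      have "Max ((\<lambda>b. \<bar>c b\<bar>) ` B) \<in> (\<lambda>b. \<bar>c b\<bar>) ` B" using fin False by (intro Max_in) auto
      then obtain m where m: "m \<in> B" "Max ((\<lambda>b. \<bar>c b\<bar>) ` B) = \<bar>c m\<bar>" by blast
      have le: "\<bar>c b\<bar> \<le> \<bar>c m\<bar>" if "b \<in> B" for b
        using that fin unfolding m(2)[symmetric] by (intro Max_ge) auto
      have "0 = g m (\<Sum>b\<in>B. c b *\<^sub>R X n b)" by (simp add: zero linear_0[OF g])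
      also have "\<dots> = (\<Sum>b\<in>B. c b * g m (X n b))"
        by (simp add: linear_sum[OF g] linear_scale[OF g])
      also have "\<dots> = (\<Sum>b\<in>B. c b * (g m (X n b) - of_bool (b = m))) + c m"
        using fin m(1) by (simp add: right_diff_distrib sum_subtractf)
      finally have "\<bar>c m\<bar> = \<bar>\<Sum>b\<in>B. c b * (g m (X n b) - of_bool (b = m))\<bar>" by linarith
      also have "\<dots> \<le> (\<Sum>b\<in>B. \<bar>c m\<bar> * \<epsilon>)"
      proof (rule order_trans[OF sum_abs sum_mono])
        fix b assume b: "b \<in> B"
        show "\<bar>c b * (g m (X n b) - of_bool (b = m))\<bar> \<le> \<bar>c m\<bar> * \<epsilon>"
          unfolding abs_mult using near[rule_format, OF m(1) b] by (intro mult_mono le[OF b]) simp_all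
      qed
      also have "\<dots> = \<bar>c m\<bar> * (card B * \<epsilon>)" by simp
      finally have "\<bar>c m\<bar> * (1 - card B * \<epsilon>) \<le> 0" by (simp add: algebra_simps)
      moreover have "card B * \<epsilon> < 1" by (simp add: \<epsilon>_def field_simps)
      ultimately have "\<bar>c m\<bar> \<le> 0" by (simp add: mult_le_0_iff)
      then show ?thesis using le by fastforce
    qed simp
  qed
qed

subsection \<open>Cones of the tropical parametrization\<close>

text \<open>Summands are labelled by positions; there are enough labels because one summand is
  selected per position. \<open>\<sigma> (i, j)\<close> is the summand attaining the minimum at
  \<open>(i, j)\<close>, and those in \<open>range \<sigma>\<close> compete.\<close>

definition trop_cone :: "('n \<times> 'n \<Rightarrow> 'n \<times> 'n) \<Rightarrow> (real^'n^('n \<times> 'n)) set" where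
  "trop_cone \<sigma> = {v. \<forall>(k, i, j) \<in> range \<sigma> \<times> UNIV.
     v $ \<sigma> (i, j) $ i + v $ \<sigma> (i, j) $ j \<le> v $ k $ i + v $ k $ j}"

text \<open>Linear on the whole space; on \<open>trop_cone \<sigma>\<close> it is the coordinatewise
  minimum over the summands in \<open>range \<sigma>\<close>.\<close>

definition trop_map :: "('n \<times> 'n \<Rightarrow> 'n \<times> 'n) \<Rightarrow> real^'n^('n \<times> 'n) \<Rightarrow> real^'n^'n" where
  "trop_map \<sigma> v = (\<chi> i j. v $ \<sigma> (i, j) $ i + v $ \<sigma> (i, j) $ j)"

lemma linear_trop_map: "linear (trop_map \<sigma>)"
  by (rule linearI) (simp_all add: trop_map_def vec_eq_iff algebra_simps)

lemma trop_coneD: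
  "v \<in> trop_cone \<sigma> \<Longrightarrow> k \<in> range \<sigma> \<Longrightarrow>
    v $ \<sigma> (i, j) $ i + v $ \<sigma> (i, j) $ j \<le> v $ k $ i + v $ k $ j"
  unfolding trop_cone_def by blast

lemma polyhedral_cone_trop_cone: "polyhedral_cone (trop_cone (\<sigma> :: 'n::finite \<times> 'n \<Rightarrow> 'n \<times> 'n))"
proof -
  let ?f = "\<lambda>(p, i, j) v :: real^'n^('n \<times> 'n). v $ \<sigma> (i, j) $ i + v $ \<sigma> (i, j) $ j - (v $ \<sigma> p $ i + v $ \<sigma> p $ j)"
  have "polyhedral_cone {v. \<forall>q. ?f q v \<le> 0}"
    by (rule polyhedral_cone_le) (auto intro!: linearI simp: algebra_simps)
  moreover have "{v. \<forall>q. ?f q v \<le> 0} = trop_cone \<sigma>"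
    unfolding trop_cone_def by auto
  ultimately show ?thesis by simp
qed

text \<open>A nonempty set in \<open>enat\<close> contains its infimum, and the infimum of the empty
  set is \<infinity>, so a finite bound is witnessed by an actual representation.\<close>

lemma sym_barvinok_rank_le_iff:
  "sym_barvinok_rank M \<le> enat r \<longleftrightarrow>
     (\<exists>s v. 0 < s \<and> s \<le> r \<and> M = trop_matrix_sum s (\<lambda>k. trop_sym_outer (v k)))"
proof -
  define P where "P s \<longleftrightarrow> (\<exists>v. M = trop_matrix_sum s (\<lambda>k. trop_sym_outer (v k)))" for s
  let ?A = "{enat s | s. s > 0 \<and> P s}"
  have "Inf ?A \<le> enat r \<longleftrightarrow> (\<exists>a\<in>?A. a \<le> enat r)"
  proof
    assume le: "Inf ?A \<le> enat r"
    have "?A \<noteq> {}"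
    proof
      assume "?A = {}"
      then show False using le unfolding Inf_enat_def by simp
    qed
    then obtain a where a: "a \<in> ?A" by blast
    have "Inf ?A = (LEAST x. x \<in> ?A)" using \<open>?A \<noteq> {}\<close> by (simp only: Inf_enat_def if_False)
    then have "Inf ?A \<in> ?A" using LeastI[of "\<lambda>x. x \<in> ?A", OF a] by (simp only:)
    then show "\<exists>a\<in>?A. a \<le> enat r" using le by blast
  qed (blast intro: Inf_lower2)
  also have "\<dots> \<longleftrightarrow> (\<exists>s. 0 < s \<and> s \<le> r \<and> P s)" by auto
  finally show ?thesis unfolding sym_barvinok_rank_def P_def by simp
qed

lemma trop_matrix_sum_sym_outer_eqI:
  assumes "k < s" "M $ i $ j = v k $ i + v k $ j"
    and "\<And>l. l < s \<Longrightarrow> M $ i $ j \<le> v l $ i + v l $ j"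
  shows "trop_matrix_sum s (\<lambda>k. trop_sym_outer (v k)) $ i $ j = M $ i $ j"
  unfolding trop_matrix_sum_def trop_sym_outer_def vec_lambda_beta
  by (rule Min_eqI) (use assms in auto)

lemma transpose_trop_matrix_sum:
  "transpose (trop_matrix_sum s (\<lambda>k. trop_sym_outer (v k))) = trop_matrix_sum s (\<lambda>k. trop_sym_outer (v k))"
  by (simp add: transpose_def trop_matrix_sum_def trop_sym_outer_def add.commute vec_eq_iff)

text \<open>Selects one minimizing summand per entry, discards those never selected and relabels the
  others by positions.\<close>

lemma sym_barvinok_rank_le_imp_trop_cone:
  fixes M :: "real^'n^'n"
  assumes "sym_barvinok_rank M \<le> enat r"
  shows "\<exists>\<sigma>. card (range \<sigma>) \<le> r \<and> M \<in> trop_map \<sigma> ` trop_cone \<sigma>"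
proof -
  obtain s v where s: "0 < s" "s \<le> r" and M: "M = trop_matrix_sum s (\<lambda>k. trop_sym_outer (v k))"
    using assms unfolding sym_barvinok_rank_le_iff by blast
  let ?f = "\<lambda>p k. v k $ fst p + v k $ snd p"
  have Mp: "M $ fst p $ snd p = Min (?f p ` {..<s})" for p
    unfolding M trop_matrix_sum_def trop_sym_outer_def by simp
  have "\<forall>p. \<exists>k. k < s \<and> M $ fst p $ snd p = ?f p k"
  proof
    fix p
    have "Min (?f p ` {..<s}) \<in> ?f p ` {..<s}" using s(1) by (intro Min_in) auto
    then show "\<exists>k. k < s \<and> M $ fst p $ snd p = ?f p k" unfolding Mp by auto
  qed
  from choice[OF this] obtain \<tau> where "\<forall>p. \<tau> p < s \<and> M $ fst p $ snd p = ?f p (\<tau> p)" ..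
  then have \<tau>: "\<tau> p < s" "M $ fst p $ snd p = ?f p (\<tau> p)" for p by blast+
  have le: "M $ fst p $ snd p \<le> ?f p k" if "k < s" for p k
    unfolding Mp using that by (intro Min_le) auto
  have fin: "finite (range \<tau>)" by simp
  have "card (range \<tau>) \<le> CARD('n \<times> 'n)" by (rule card_image_le) simp
  then obtain g :: "nat \<Rightarrow> 'n \<times> 'n" where g: "inj_on g (range \<tau>)"
    using card_le_inj[OF fin finite] by metis
  define \<sigma> where "\<sigma> = g \<circ> \<tau>"
  \<comment> \<open>Labels outside \<open>range \<sigma>\<close> receive an unspecified vector,
    which enters neither the cone inequalities nor the map.\<close>
  define V :: "real^'n^('n \<times> 'n)" where "V = (\<chi> k. v (inv_into (range \<tau>) g k))"
  have V: "V $ \<sigma> p = v (\<tau> p)" for p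
    using g by (simp add: V_def \<sigma>_def)
  have "card (range \<sigma>) \<le> card (range \<tau>)"
    unfolding \<sigma>_def image_comp[symmetric] by (rule card_image_le[OF fin])
  also have "\<dots> \<le> card {..<s}" using \<tau>(1) by (intro card_mono) auto
  finally have "card (range \<sigma>) \<le> r" using s(2) by simp
  moreover have "V \<in> trop_cone \<sigma>"
    unfolding trop_cone_def
  proof (intro CollectI ballI)
    fix q :: "('n \<times> 'n) \<times> 'n \<times> 'n" assume "q \<in> range \<sigma> \<times> UNIV"
    then obtain p i j where q: "q = (\<sigma> p, i, j)" by auto
    show "case q of (k, i, j) \<Rightarrow> V $ \<sigma> (i, j) $ i + V $ \<sigma> (i, j) $ j \<le> V $ k $ i + V $ k $ j"
      unfolding q using \<tau>(2)[of "(i, j)"] le[OF \<tau>(1), of "(i, j)" p] by (simp add: V)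
  qed
  moreover have "M = trop_map \<sigma> V"
  proof -
    have "M $ i $ j = trop_map \<sigma> V $ i $ j" for i j
      using \<tau>(2)[of "(i, j)"] by (simp add: trop_map_def V)
    then show ?thesis by (simp add: vec_eq_iff)
  qed
  ultimately show ?thesis by blast
qed

lemma trop_cone_imp_sym_barvinok_rank_le:
  fixes M :: "real^'n^'n"
  assumes "card (range \<sigma>) \<le> r" "M \<in> trop_map \<sigma> ` trop_cone \<sigma>"
  shows "transpose M = M \<and> sym_barvinok_rank M \<le> enat r"
proof -
  obtain V where V: "V \<in> trop_cone \<sigma>" "M = trop_map \<sigma> V" using assms(2) by blast
  have "0 < card (range \<sigma>)" by (simp add: card_gt_0_iff)
  obtain h where h: "bij_betw h {0..<card (range \<sigma>)} (range \<sigma>)"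
    using ex_bij_betw_nat_finite[of "range \<sigma>"] by auto
  let ?N = "trop_matrix_sum (card (range \<sigma>)) (\<lambda>k. trop_sym_outer (V $ h k))"
  have "?N $ i $ j = M $ i $ j" for i j
  proof -
    have "\<sigma> (i, j) \<in> h ` {0..<card (range \<sigma>)}" using bij_betw_imp_surj_on[OF h] by blast
    then obtain k where k: "k < card (range \<sigma>)" "h k = \<sigma> (i, j)" by fastforce
    have M: "M $ i $ j = V $ h k $ i + V $ h k $ j" by (simp add: V(2) trop_map_def k(2))
    have "M $ i $ j \<le> V $ h l $ i + V $ h l $ j" if "l < card (range \<sigma>)" for l
    proof -
      have "h l \<in> range \<sigma>" using bij_betwE[OF h] that by simp
      from trop_coneD[OF V(1) this] show ?thesis unfolding M k(2) .
    qed
    with k(1) M show ?thesis by (rule trop_matrix_sum_sym_outer_eqI)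
  qed
  then have "M = ?N" by (simp add: vec_eq_iff)
  then show ?thesis
    unfolding sym_barvinok_rank_le_iff
    using transpose_trop_matrix_sum[of "card (range \<sigma>)" "\<lambda>k. V $ h k"] assms(1) \<open>0 < card (range \<sigma>)\<close>
    by metis
qed

section \<open>Upper bound through the classical differential\<close>

text \<open>Using \<open>span\<close>, skewness on \<open>I\<close> and \<open>span\<close> again
  expresses \<open>a j l\<close> through entries \<open>a i' i\<close> with both indices in
  \<open>I\<close>; symmetrizing leaves only the sums \<open>a i' i + a i i'\<close>, which are
  0.\<close>

lemma skew_if_skew_on_spanning_rows:
  fixes a :: "'n \<Rightarrow> 'n \<Rightarrow> 'f::comm_ring_1"
  assumes span: "\<And>j l. a j l = (\<Sum>i\<in>I. w j i * a i l)"
    and skew: "\<And>i l. i \<in> I \<Longrightarrow> a i l + a l i = 0"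
  shows "a j l + a l j = 0"
proof -
  have expand: "a j l = - (\<Sum>i\<in>I. \<Sum>i'\<in>I. w j i * w l i' * a i' i)" for j l
  proof -
    have "a j l = (\<Sum>i\<in>I. w j i * - a l i)"
      unfolding span[of j l] using skew by (intro sum.cong refl) (metis eq_neg_iff_add_eq_0)
    also have "\<dots> = (\<Sum>i\<in>I. w j i * - (\<Sum>i'\<in>I. w l i' * a i' i))"
      by (simp only: span[of l, symmetric])
    finally show ?thesis by (simp add: sum_negf sum_distrib_left mult.assoc)
  qed
  have "a l j = - (\<Sum>i\<in>I. \<Sum>i'\<in>I. w j i * w l i' * a i i')"
    unfolding expand[of l j] by (subst sum.swap) (simp add: ac_simps)
  then have "a j l + a l j = - (\<Sum>i\<in>I. \<Sum>i'\<in>I. w j i * w l i' * (a i' i + a i i'))"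
    unfolding expand[of j l] by (simp add: sum.distrib distrib_left)
  also have "\<dots> = 0" using skew by (simp add: add.commute)
  finally show ?thesis .
qed

text \<open>The differential of \<open>(x k)\<^sub>k \<mapsto> \<Sum>k. x k (x k)\<^sup>T\<close> in logarithmic coordinates, at the point
  \<open>x k i = exp (- t * v k i)\<close>. For large \<open>t\<close> it approximates the tropical parametrization.\<close>

definition log_weight :: "'k set \<Rightarrow> ('k \<Rightarrow> 'n \<Rightarrow> real) \<Rightarrow> real \<Rightarrow> 'n \<Rightarrow> 'n \<Rightarrow> 'k \<Rightarrow> real" where
  "log_weight K v t i j k = exp (- t * (v k i + v k j)) / (\<Sum>l\<in>K. exp (- t * (v l i + v l j)))"

definition log_differential ::
  "'k set \<Rightarrow> ('k \<Rightarrow> 'n \<Rightarrow> real) \<Rightarrow> real \<Rightarrow> ('k \<Rightarrow> 'n \<Rightarrow> real) \<Rightarrow> 'n \<Rightarrow> 'n \<Rightarrow> real" where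
  "log_differential K v t u i j = (\<Sum>k\<in>K. log_weight K v t i j k * (u k i + u k j))"

lemma log_differential_commute: "log_differential K v t u i j = log_differential K v t u j i"
  by (simp add: log_differential_def log_weight_def add.commute)

text \<open>Up to positive denominators the differential is \<open>a + a\<^sup>T\<close>, where
  \<open>a\<close> is the product of \<open>A\<close> with another matrix, so rows spanning those of
  \<open>A\<close> also span those of \<open>a\<close>. The set \<open>I\<close> depends on
  \<open>v\<close> and \<open>t\<close>, but one choice serves all \<open>u\<close>.\<close>

lemma log_differential_determined:
  fixes K :: "'k::finite set" and v :: "'k \<Rightarrow> 'n::finite \<Rightarrow> real"
  assumes "K \<noteq> {}"
  shows "\<exists>I. card I \<le> card K \<and> (\<forall>u.
    (\<forall>i\<in>I. \<forall>j. log_differential K v t u i j = 0) \<longrightarrow> (\<forall>i j. log_differential K v t u i j = 0))"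
proof -
  \<comment> \<open>The point of the curve at time \<open>t\<close>; zero columns outside
    \<open>K\<close> bound the rank by \<open>card K\<close>.\<close>
  define A :: "real^'k^'n" where "A = (\<chi> i k. if k \<in> K then exp (- t * v k i) else 0)"
  have "rank A \<le> card K"
  proof (rule rank_le_card_if_rows_spanned[where w = "\<lambda>j k. A $ j $ k" and u = "\<lambda>k. axis k 1"])
    show "row j A = (\<Sum>k\<in>K. A $ j $ k *s axis k 1)" for j
      by (simp add: vec_eq_iff row_def axis_def if_distrib[of "\<lambda>x. _ * x"] sum.delta' cong: if_cong)
        (simp add: A_def)
  qed simp
  moreover obtain I where I: "card I \<le> rank A" "\<forall>j. \<exists>w. \<forall>k. A $ j $ k = (\<Sum>i\<in>I. w i * A $ i $ k)"
    using rows_spanned_by_few by metis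
  moreover have "log_differential K v t u i j = 0"
    if zero: "\<forall>i\<in>I. \<forall>j. log_differential K v t u i j = 0" for u i j
  proof -
    from choice[OF I(2)] obtain w where w: "\<forall>j k. A $ j $ k = (\<Sum>i\<in>I. w j i * A $ i $ k)" ..
    define a where "a i j = (\<Sum>k\<in>K. A $ i $ k * (A $ j $ k * u k j))" for i j
    define s where "s i j = (\<Sum>l\<in>K. exp (- t * (v l i + v l j)))" for i j
    have "s i j > 0" for i j unfolding s_def using assms by (intro sum_pos) auto
    then have s: "s i j \<noteq> 0" for i j by (metis less_irrefl)
    have "a i j + a j i = (\<Sum>k\<in>K. exp (- t * (v k i + v k j)) * (u k i + u k j))" for i j
      unfolding a_def sum.distrib[symmetric]
      by (intro sum.cong refl) (simp add: A_def algebra_simps exp_add exp_diff exp_minus divide_inverse)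
    then have a: "log_differential K v t u i j = (a i j + a j i) / s i j" for i j
      by (simp add: log_differential_def log_weight_def s_def sum_divide_distrib)
    have "a j l = (\<Sum>i\<in>I. w j i * a i l)" for j l
    proof -
      have "a j l = (\<Sum>k\<in>K. \<Sum>i\<in>I. w j i * (A $ i $ k * (A $ l $ k * u k l)))"
        unfolding a_def w[rule_format, of j] by (simp add: sum_distrib_right mult.assoc)
      then show ?thesis unfolding a_def by (simp add: sum.swap[of _ I K] sum_distrib_left)
    qed
    moreover have "a i l + a l i = 0" if "i \<in> I" for i l
    proof -
      have "(a i l + a l i) / s i l = 0" using zero that unfolding a by blast
      then show ?thesis using s[of i l] by simp
    qed
    ultimately have "a i j + a j i = 0" by (rule skew_if_skew_on_spanning_rows)
    then show ?thesis unfolding a by simp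
  qed
  ultimately show ?thesis by (metis order_trans)
qed

text \<open>Comparing the denominator with its term at \<open>m\<close> makes the weight
  exponentially small in the gap between the two sums.\<close>

lemma log_weight_tendsto_0:
  assumes "finite K" "k \<in> K" "m \<in> K" "v m i + v m j < v k i + v k j"
  shows "(\<lambda>n. log_weight K v (real n) i j k) \<longlonglongrightarrow> 0"
proof -
  define \<delta> where "\<delta> = v k i + v k j - (v m i + v m j)"
  have \<delta>: "\<delta> > 0" using assms(4) by (simp add: \<delta>_def)
  have "(\<lambda>n. exp (- \<delta>) ^ n) \<longlonglongrightarrow> 0" using \<delta> by (intro LIMSEQ_power_zero) simp
  then have lim: "(\<lambda>n. exp (- \<delta> * real n)) \<longlonglongrightarrow> 0" unfolding exp_of_nat2_mult .
  have bound: "\<bar>log_weight K v (real n) i j k\<bar> \<le> exp (- \<delta> * real n)" for n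
  proof -
    let ?e = "\<lambda>l. exp (- real n * (v l i + v l j))"
    have sum: "?e m \<le> (\<Sum>l\<in>K. ?e l)" using assms(1,3) by (intro member_le_sum) auto
    have "\<bar>log_weight K v (real n) i j k\<bar> = ?e k / (\<Sum>l\<in>K. ?e l)"
      unfolding log_weight_def by (intro abs_of_nonneg divide_nonneg_nonneg sum_nonneg) auto
    also have "\<dots> \<le> ?e k / ?e m" using sum by (intro divide_left_mono mult_pos_pos) (auto intro: less_le_trans[OF exp_gt_zero])
    also have "\<dots> = exp (- \<delta> * real n)" by (simp add: \<delta>_def algebra_simps flip: exp_diff)
    finally show ?thesis .
  qed
  show ?thesis
    by (rule Lim_null_comparison[OF _ lim]) (use bound in \<open>simp add: real_norm_def\<close>)
qed

text \<open>The weights at an entry sum to 1, so the differential averages the values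
  \<open>u k i + u k j\<close>. Values that differ from the one at \<open>m\<close> have weights
  tending to 0.\<close>

lemma log_differential_tendsto:
  assumes K: "finite K" "m \<in> K"
    and gap: "\<And>k. k \<in> K \<Longrightarrow> u k i + u k j = u m i + u m j \<or> v m i + v m j < v k i + v k j"
  shows "(\<lambda>n. log_differential K v (real n) u i j) \<longlonglongrightarrow> u m i + u m j"
proof -
  let ?d = "\<lambda>k. u k i + u k j - (u m i + u m j)"
  have total: "(\<Sum>k\<in>K. log_weight K v t i j k) = 1" for t
  proof -
    have "(\<Sum>l\<in>K. exp (- t * (v l i + v l j))) > 0" using K by (intro sum_pos) auto
    then show ?thesis by (simp add: log_weight_def flip: sum_divide_distrib)
  qed
  have "log_differential K v t u i j = (\<Sum>k\<in>K. log_weight K v t i j k * ?d k) + (u m i + u m j)" for t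
  proof -
    have "(\<Sum>k\<in>K. log_weight K v t i j k * ?d k)
        = log_differential K v t u i j - (\<Sum>k\<in>K. log_weight K v t i j k) * (u m i + u m j)"
      by (simp add: log_differential_def right_diff_distrib sum_subtractf sum_distrib_right)
    then show ?thesis by (simp add: total)
  qed
  moreover have "(\<lambda>n. (\<Sum>k\<in>K. log_weight K v (real n) i j k * ?d k)) \<longlonglongrightarrow> 0"
  proof (rule tendsto_null_sum)
    fix k assume k: "k \<in> K"
    show "(\<lambda>n. log_weight K v (real n) i j k * ?d k) \<longlonglongrightarrow> 0"
    proof (cases "?d k = 0")
      case False
      then have "v m i + v m j < v k i + v k j" using gap[OF k] by simp
      from tendsto_mult_left_zero[OF log_weight_tendsto_0[OF K(1) k K(2) this]] show ?thesis .
    qed simp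
  qed
  ultimately show ?thesis
    using tendsto_add[OF _ tendsto_const[of "u m i + u m j"]] by fastforce
qed

text \<open>Were there too many independent matrices in the image, their approximations by a
  classical differential would stay independent for large \<open>t\<close>; but values of that
  differential are determined by the entries touching a small set \<open>I\<close>.\<close>

lemma dim_trop_map_trop_cone_le:
  fixes \<sigma> :: "'n::finite \<times> 'n \<Rightarrow> 'n \<times> 'n"
  assumes "card (range \<sigma>) \<le> r"
  shows "dim (trop_map \<sigma> ` trop_cone \<sigma>) \<le> (CARD('n) + 1 choose 2) - (CARD('n) + 1 - r choose 2)"
    (is "_ \<le> ?d")
proof (rule ccontr)
  assume neg: "\<not> ?thesis"
  have P: "convex_cone (trop_cone \<sigma>)"
    using polyhedral_cone_trop_cone[of \<sigma>] by (simp add: polyhedral_cone_def)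
  obtain B where B: "B \<subseteq> trop_map \<sigma> ` trop_cone \<sigma>" "independent B"
    "card B = dim (trop_map \<sigma> ` trop_cone \<sigma>)"
    using basis_exists[of "trop_map \<sigma> ` trop_cone \<sigma>"] by metis
  have fin: "finite B" using B(2) independent_imp_finite by blast
  have "\<forall>b\<in>B. \<exists>u. u \<in> trop_cone \<sigma> \<and> trop_map \<sigma> u = b" using B(1) by blast
  from bchoice[OF this] obtain U where U: "\<forall>b\<in>B. U b \<in> trop_cone \<sigma> \<and> trop_map \<sigma> (U b) = b" ..
  let ?K = "range \<sigma>"
  \<comment> \<open>With \<open>q = (k, i, j)\<close>, this is the slack of the cone inequality for
    summand \<open>k\<close> at \<open>(i, j)\<close>.\<close>
  define g where "g q v = v $ fst q $ fst (snd q) + v $ fst q $ snd (snd q) -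
      (v $ \<sigma> (snd q) $ fst (snd q) + v $ \<sigma> (snd q) $ snd (snd q))"
    for q :: "('n \<times> 'n) \<times> 'n \<times> 'n" and v :: "real^'n^('n \<times> 'n)"
  \<comment> \<open>At a generic \<open>v\<close>, an inequality is tight only if it is tight on the
    whole cone. This gives the gap condition of the limit for every \<open>u\<close> in the
    cone.\<close>
  have "\<exists>v\<in>trop_cone \<sigma>. \<forall>q\<in>?K \<times> UNIV. g q v = 0 \<longrightarrow> (\<forall>x\<in>trop_cone \<sigma>. g q x = 0)"
  proof (rule convex_cone_generic_point[OF P finite])
    show "linear (g q)" for q by (rule linearI) (simp_all add: g_def algebra_simps)
    show "0 \<le> g q x" if q: "q \<in> ?K \<times> UNIV" and x: "x \<in> trop_cone \<sigma>" for q x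
    proof -
      obtain k i j where "q = (k, i, j)" "k \<in> ?K" using q by (metis SigmaE prod.collapse)
      then show ?thesis using trop_coneD[OF x, of k i j] by (simp add: g_def)
    qed
  qed
  then obtain v where v: "v \<in> trop_cone \<sigma>"
    "\<forall>q\<in>?K \<times> UNIV. g q v = 0 \<longrightarrow> (\<forall>x\<in>trop_cone \<sigma>. g q x = 0)" by (rule bexE)
  let ?v = "\<lambda>k i. v $ k $ i"
  define J where "J t u = (\<chi> i j. log_differential ?K ?v t (\<lambda>k i. u $ k $ i) i j)"
    for t and u :: "real^'n^('n \<times> 'n)"
  have lim: "(\<lambda>n. J (real n) u) \<longlonglongrightarrow> trop_map \<sigma> u" if u: "u \<in> trop_cone \<sigma>" for u
  proof (intro vec_tendstoI)
    fix i j
    have "(\<lambda>n. log_differential ?K ?v (real n) (\<lambda>k i. u $ k $ i) i j)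
      \<longlonglongrightarrow> u $ \<sigma> (i, j) $ i + u $ \<sigma> (i, j) $ j"
    proof (rule log_differential_tendsto[OF finite rangeI])
      fix k assume k: "k \<in> ?K"
      show "u $ k $ i + u $ k $ j = u $ \<sigma> (i, j) $ i + u $ \<sigma> (i, j) $ j \<or>
        v $ \<sigma> (i, j) $ i + v $ \<sigma> (i, j) $ j < v $ k $ i + v $ k $ j"
      proof (rule disjCI)
        assume "\<not> v $ \<sigma> (i, j) $ i + v $ \<sigma> (i, j) $ j < v $ k $ i + v $ k $ j"
        then have "g (k, i, j) v = 0" using trop_coneD[OF v(1) k, of i j] by (simp add: g_def)
        then have "g (k, i, j) u = 0" using v(2) k u by blast
        then show "u $ k $ i + u $ k $ j = u $ \<sigma> (i, j) $ i + u $ \<sigma> (i, j) $ j"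
          by (simp add: g_def)
      qed
    qed
    then show "(\<lambda>n. J (real n) u $ i $ j) \<longlonglongrightarrow> trop_map \<sigma> u $ i $ j"
      by (simp add: J_def trop_map_def)
  qed
  have "(\<lambda>n. J (real n) (U b)) \<longlonglongrightarrow> b" if "b \<in> B" for b
    using lim[of "U b"] U that by simp
  from independent_limit[OF B(2) this] obtain n where
    n: "\<And>c. (\<Sum>b\<in>B. c b *\<^sub>R J (real n) (U b)) = 0 \<Longrightarrow> \<forall>b\<in>B. c b = 0"
    unfolding eventually_sequentially by blast
  obtain I where I: "card I \<le> card ?K" "\<forall>u.
    (\<forall>i\<in>I. \<forall>j. log_differential ?K ?v (real n) u i j = 0) \<longrightarrow>
    (\<forall>i j. log_differential ?K ?v (real n) u i j = 0)"
    using log_differential_determined[of ?K ?v "real n"] by blast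
  have "\<forall>b. \<exists>e. \<forall>a. \<forall>i\<in>I. e {a, i} = J (real n) (U b) $ a $ i"
    by (intro allI exists_on_pairs) (simp add: J_def, rule log_differential_commute)
  from choice[OF this] obtain e where e: "\<forall>b a. \<forall>i\<in>I. e b {a, i} = J (real n) (U b) $ a $ i" ..
  have "card (pairs_touching I) < card B"
    using card_pairs_touching_le[of I r] I(1) assms neg B(3) by linarith
  from homogeneous_system_nontrivial[OF fin finite_pairs_touching this, of e]
  obtain c where c: "\<exists>b\<in>B. c b \<noteq> 0" "\<forall>p\<in>pairs_touching I. (\<Sum>b\<in>B. c b * e b p) = 0" by blast
  \<comment> \<open>A combination of tangent vectors whose differential vanishes at the entries
    touching \<open>I\<close>, hence everywhere, against independence for this
    \<open>n\<close>.\<close>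
  define u where "u = (\<Sum>b\<in>B. c b *\<^sub>R U b)"
  have "linear (J (real n))"
    by (rule linearI) (simp_all add: J_def log_differential_def vec_eq_iff algebra_simps
        sum.distrib sum_distrib_left)
  then have Ju: "J (real n) u = (\<Sum>b\<in>B. c b *\<^sub>R J (real n) (U b))"
    by (simp add: u_def linear_sum linear_scale)
  have "J (real n) u $ a $ i = 0" if "i \<in> I" for a i
  proof -
    have "{a, i} \<in> pairs_touching I" using that by (auto simp: pairs_touching_def insert_commute)
    then have "(\<Sum>b\<in>B. c b * e b {a, i}) = 0" using c(2) by blast
    moreover have "e b {a, i} = J (real n) (U b) $ a $ i" for b using e that by blast
    ultimately show ?thesis unfolding Ju by simp
  qed
  then have "\<forall>i\<in>I. \<forall>j. log_differential ?K ?v (real n) (\<lambda>k i. u $ k $ i) i j = 0"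
    unfolding J_def vec_lambda_beta by (metis log_differential_commute)
  with I(2) have "\<forall>i j. log_differential ?K ?v (real n) (\<lambda>k i. u $ k $ i) i j = 0" by blast
  then have "J (real n) u = 0" by (simp add: J_def vec_eq_iff)
  then show False using n[of c] c(1) unfolding Ju by blast
qed

subsection \<open>Prescribing entries\<close>

definition pair_matrix :: "'n set \<Rightarrow> real^'n^'n" where
  "pair_matrix b = (\<chi> i j. of_bool ({i, j} = b))"

text \<open>Matrices of distinct pairs have disjoint supports, hence are orthogonal.\<close>

lemma independent_pair_matrices:
  "independent (pair_matrix ` pairs_touching I)" (is ?indep)
  and inj_on_pair_matrix: "inj_on pair_matrix (pairs_touching (I :: 'n::finite set))"
proof -
  have ortho: "pair_matrix b \<bullet> pair_matrix b' = 0" if "b \<noteq> b'" for b b' :: "'n set"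
    using that by (auto simp: pair_matrix_def inner_vec_def intro!: sum.neutral)
  have nonzero: "pair_matrix b \<noteq> 0" if b: "b \<in> pairs_touching I" for b
  proof
    obtain i j where "b = {i, j}" using b by (auto simp: pairs_touching_def)
    then have "pair_matrix b $ i $ j = 1" by (simp add: pair_matrix_def)
    moreover assume "pair_matrix b = 0"
    ultimately show False by simp
  qed
  show "inj_on pair_matrix (pairs_touching I)"
    using ortho nonzero by (metis inj_onI inner_eq_zero_iff)
  show ?indep
  proof (rule pairwise_orthogonal_independent)
    show "pairwise orthogonal (pair_matrix ` pairs_touching I)"
      unfolding pairwise_def orthogonal_def using ortho by (metis imageE)
    show "0 \<notin> pair_matrix ` pairs_touching I" using nonzero by (metis imageE)
  qed
qed

text \<open>Around the matrix with diagonal \<open>0\<close> and off-diagonal entries \<open>1\<close>, the vector number \<open>k\<close>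
  can be chosen to produce the entries \<open>(k, j)\<close> with \<open>j \<ge> k\<close> of a prescribed matrix; the vectors
  with smaller number are too large there since \<open>1 + 1 - 0 > 1\<close>.\<close>

lemma sym_barvinok_rank_le_prescribed:
  fixes M :: "real^'n^'n" and e :: "'n \<Rightarrow> nat"
  assumes e: "inj e" "range e = {0..<CARD('n)}" and "0 < r"
    and sym: "\<And>i j. M $ i $ j = M $ j $ i"
    and diag: "\<And>i. \<bar>M $ i $ i\<bar> \<le> 1 / 10" and off: "\<And>i j. i \<noteq> j \<Longrightarrow> \<bar>M $ i $ j - 1\<bar> \<le> 1 / 10"
  shows "\<exists>N. transpose N = N \<and> sym_barvinok_rank N \<le> enat r \<and>
    (\<forall>i j. e i < r \<or> e j < r \<longrightarrow> N $ i $ j = M $ i $ j)"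
proof -
  define p where "p k = inv e k" for k
  have p: "p (e i) = i" for i using e(1) by (simp add: p_def)
  have ep: "e (p k) = k" if "k < CARD('n)" for k
    unfolding p_def by (rule f_inv_into_f) (simp add: e(2) that)
  have eN: "e i < CARD('n)" for i using e(2) by (metis atLeastLessThan_iff rangeI)
  \<comment> \<open>Half the diagonal entry at \<open>p k\<close> makes the outer sum agree with
    \<open>M\<close> at the entries \<open>(p k, j)\<close> with \<open>k \<le> e j\<close>; the
    value 10 keeps vector \<open>k\<close> too large in rows of smaller number. For
    \<open>k \<ge> CARD('n)\<close> all entries are 10.\<close>
  define v :: "nat \<Rightarrow> real^'n" where "v k = (\<chi> i. if e i < k then 10
    else if e i = k then M $ i $ i / 2 else M $ p k $ i - M $ p k $ p k / 2)" for k
  have big: "v k $ i = 10" if "e i < k" for i k using that by (simp add: v_def)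
  \<comment> \<open>The bound is 9/10 - 1/20. Two such values exceed 11/10, the upper bound for the
    entries of \<open>M\<close>.\<close>
  have pos: "17 / 20 \<le> v k $ i" if "k \<noteq> e i" for i k
  proof (cases "e i < k")
    case False
    then have "k < e i" using that by simp
    have "p k \<noteq> i" using ep[of k] eN[of i] \<open>k < e i\<close> by auto
    then have "17 / 20 \<le> M $ p k $ i - M $ p k $ p k / 2"
      using off[of "p k" i] diag[of "p k"] unfolding abs_le_iff by linarith
    then show ?thesis using \<open>k < e i\<close> by (simp add: v_def)
  qed (simp add: big)
  have low: "- 1 / 20 \<le> v k $ i" for i k
  proof (cases "k = e i")
    case True
    then show ?thesis using diag[of i] by (simp add: v_def abs_le_iff)
  next
    case False
    then show ?thesis using pos[of k i] by linarith
  qed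
  have up: "M $ i $ j \<le> 11 / 10" for i j
  proof (cases "i = j")
    case True
    then show ?thesis using diag[of i] unfolding abs_le_iff by simp
  next
    case False
    from off[OF this] show ?thesis unfolding abs_le_iff by linarith
  qed
  let ?N = "trop_matrix_sum r (\<lambda>k. trop_sym_outer (v k))"
  have N: "transpose ?N = ?N" by (rule transpose_trop_matrix_sum)
  have entry: "?N $ i $ j = M $ i $ j" if ij: "e i < r" "e i \<le> e j" for i j
  proof (rule trop_matrix_sum_sym_outer_eqI[OF ij(1)])
    show eq: "M $ i $ j = v (e i) $ i + v (e i) $ j"
    proof (cases "i = j")
      case False
      then have "e i \<noteq> e j" using e(1) by (metis injD)
      then show ?thesis using ij(2) by (simp add: v_def p)
    qed (simp add: v_def)
    fix l assume "l < r"
    consider "l = e i" | "e i < l" | "l < e i" by linarith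
    then show "M $ i $ j \<le> v l $ i + v l $ j"
    proof cases
      case 1
      then show ?thesis using eq by simp
    next
      case 2
      then show ?thesis using big[of i l] low[of l j] up[of i j] by simp
    next
      case 3
      then show ?thesis using pos[of l i] pos[of l j] ij(2) up[of i j] by simp
    qed
  qed
  have "?N $ i $ j = M $ i $ j" if "e i < r \<or> e j < r" for i j
  proof (cases "e i \<le> e j")
    case True
    then show ?thesis using that by (intro entry) auto
  next
    case False
    then have "?N $ j $ i = M $ j $ i" using that by (intro entry) auto
    moreover have "?N $ i $ j = ?N $ j $ i" using N by (metis transpose_def vec_lambda_beta)
    ultimately show ?thesis using sym by simp
  qed
  moreover have "sym_barvinok_rank ?N \<le> enat r"
    unfolding sym_barvinok_rank_le_iff using \<open>0 < r\<close> by blast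
  ultimately show ?thesis using N by blast
qed

text \<open>After projection to the entries touching \<open>I\<close>, every symmetric matrix near
  the one with diagonal 0 and off-diagonal entries 1 comes from the tropical set. Pair matrices are
  scaled differences of such matrices.\<close>

lemma conical_dim_sym_barvinok_rank_ge:
  fixes F :: "(real^'n^'n) set set"
  assumes "0 < r" and F: "cone_decomposition F {M. transpose M = M \<and> sym_barvinok_rank M \<le> enat r}"
  shows "\<exists>C\<in>F. (CARD('n) + 1 choose 2) - (CARD('n) + 1 - r choose 2) \<le> dim C"
proof -
  obtain e :: "'n \<Rightarrow> nat" where e: "bij_betw e UNIV {0..<CARD('n)}"
    using ex_bij_betw_finite_nat[OF finite] by metis
  then have inj: "inj e" and ran: "range e = {0..<CARD('n)}" by (simp_all add: bij_betw_def)
  define I where "I = {i. e i < r}"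
  have "e ` I = {0..<min r CARD('n)}"
  proof
    show "e ` I \<subseteq> {0..<min r CARD('n)}" using ran unfolding I_def by fastforce
    show "{0..<min r CARD('n)} \<subseteq> e ` I"
    proof
      fix k assume k: "k \<in> {0..<min r CARD('n)}"
      then have "k \<in> range e" using ran by simp
      then show "k \<in> e ` I" using k unfolding I_def by auto
    qed
  qed
  then have "card I = min r CARD('n)"
    using card_image[of e I] inj by (metis card_atLeastLessThan diff_zero inj_on_subset subset_UNIV)
  then have card: "card (pair_matrix ` pairs_touching I :: (real^'n^'n) set) =
      (CARD('n) + 1 choose 2) - (CARD('n) + 1 - r choose 2)"
    using card_pairs_touching_min[of I r] by (simp add: card_image[OF inj_on_pair_matrix])
  define \<pi> :: "real^'n^'n \<Rightarrow> real^'n^'n" where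
    "\<pi> M = (\<chi> i j. if i \<in> I \<or> j \<in> I then M $ i $ j else 0)" for M
  have lin: "linear \<pi>" by (rule linearI) (simp_all add: \<pi>_def vec_eq_iff)
  let ?K = "{M :: real^'n^'n. (\<forall>i j. M $ i $ j = M $ j $ i) \<and> (\<forall>i j. \<bar>M $ i $ j - of_bool (i \<noteq> j)\<bar> \<le> 1 / 10)}"
  have "\<exists>C\<in>F. card (pair_matrix ` pairs_touching I :: (real^'n^'n) set) \<le> dim C"
  proof (rule conical_dim_lower_bound[OF F lin _ _ _ independent_pair_matrices])
    show "convex ?K"
    proof (rule convexI, intro CollectI conjI allI)
      fix x y :: "real^'n^'n" and s t :: real and i j
      assume x: "x \<in> ?K" and y: "y \<in> ?K" and st: "0 \<le> s" "0 \<le> t" "s + t = 1"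
      show "(s *\<^sub>R x + t *\<^sub>R y) $ i $ j = (s *\<^sub>R x + t *\<^sub>R y) $ j $ i" using x y by simp
      let ?o = "of_bool (i \<noteq> j) :: real"
      have "(s *\<^sub>R x + t *\<^sub>R y) $ i $ j - ?o = s * (x $ i $ j - ?o) + t * (y $ i $ j - ?o) + (s + t - 1) * ?o"
        by (simp add: algebra_simps)
      also have "\<dots> = s * (x $ i $ j - ?o) + t * (y $ i $ j - ?o)" by (simp add: st(3))
      also have "\<bar>\<dots>\<bar> \<le> s * \<bar>x $ i $ j - ?o\<bar> + t * \<bar>y $ i $ j - ?o\<bar>"
        using st by (intro order_trans[OF abs_triangle_ineq]) (simp add: abs_mult)
      also have "\<dots> \<le> s * (1 / 10) + t * (1 / 10)"
        using x y st by (intro add_mono mult_left_mono) blast+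
      also have "\<dots> = (s + t) * (1 / 10)" by (rule distrib_right[symmetric])
      finally show "\<bar>(s *\<^sub>R x + t *\<^sub>R y) $ i $ j - ?o\<bar> \<le> 1 / 10" using st(3) by simp
    qed
    have base: "(\<chi> i j. of_bool (i \<noteq> j)) \<in> ?K" by auto
    then show "?K \<noteq> {}" by blast
    show "\<pi> ` ?K \<subseteq> \<pi> ` {M. transpose M = M \<and> sym_barvinok_rank M \<le> enat r}"
    proof
      fix y assume "y \<in> \<pi> ` ?K"
      then obtain M where M: "M \<in> ?K" "y = \<pi> M" by blast
      have sym: "M $ i $ j = M $ j $ i" and near: "\<bar>M $ i $ j - of_bool (i \<noteq> j)\<bar> \<le> 1 / 10" for i j
        using M(1) by blast+
      have "\<bar>M $ i $ i\<bar> \<le> 1 / 10" for i using near[of i i] by simp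
      moreover have "\<bar>M $ i $ j - 1\<bar> \<le> 1 / 10" if "i \<noteq> j" for i j using near[of i j] that by simp
      ultimately obtain N where N: "transpose N = N \<and> sym_barvinok_rank N \<le> enat r"
        "\<forall>i j. e i < r \<or> e j < r \<longrightarrow> N $ i $ j = M $ i $ j"
        using sym_barvinok_rank_le_prescribed[OF inj ran \<open>0 < r\<close> sym] by blast
      then have "\<pi> N = y" unfolding M(2) by (simp add: \<pi>_def I_def vec_eq_iff)
      then show "y \<in> \<pi> ` {M. transpose M = M \<and> sym_barvinok_rank M \<le> enat r}" using N(1) by blast
    qed
    fix E assume "E \<in> pair_matrix ` pairs_touching I"
    then obtain b where b: "b \<in> pairs_touching I" "E = pair_matrix b" by blast
    let ?M0 = "(\<chi> i j. of_bool (i \<noteq> j)) :: real^'n^'n"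
    have "\<pi> E = E"
      using b(1) by (auto simp: b(2) \<pi>_def pair_matrix_def vec_eq_iff pairs_touching_def doubleton_eq_iff)
    \<comment> \<open>The step 1/10 keeps the perturbed matrix in the box \<open>?K\<close>.\<close>
    then have "E = 10 *\<^sub>R (\<pi> (?M0 + (1 / 10) *\<^sub>R E) - \<pi> ?M0)"
      by (simp add: linear_add[OF lin] linear_scale[OF lin])
    moreover have "?M0 + (1 / 10) *\<^sub>R E \<in> ?K"
      by (auto simp: b(2) pair_matrix_def insert_commute)
    ultimately show "\<exists>x\<in>?K. \<exists>y\<in>?K. \<exists>t. E = t *\<^sub>R (\<pi> x - \<pi> y)" using base by blast
  qed
  then show ?thesis unfolding card .
qed

lemma has_conical_dim_sym_barvinok_rank_le:
  assumes "0 < r"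
  shows "has_conical_dim {M :: real^'n^'n. transpose M = M \<and> sym_barvinok_rank M \<le> enat r}
    ((CARD('n) + 1 choose 2) - (CARD('n) + 1 - r choose 2))"
proof (rule has_conical_dimI)
  let ?\<Sigma> = "{\<sigma> :: 'n \<times> 'n \<Rightarrow> 'n \<times> 'n. card (range \<sigma>) \<le> r}"
  let ?F = "(\<lambda>\<sigma>. trop_map \<sigma> ` trop_cone \<sigma>) ` ?\<Sigma>"
  show "dim C \<le> (CARD('n) + 1 choose 2) - (CARD('n) + 1 - r choose 2)" if "C \<in> ?F" for C
    using that dim_trop_map_trop_cone_le by blast
  \<comment> \<open>A constant map selects a single summand everywhere, so it qualifies because
    \<open>r\<close> is positive.\<close>
  have "(\<lambda>_. undefined) \<in> ?\<Sigma>" using assms by simp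
  then have "?F \<noteq> {}" by blast
  moreover have "finite ?F" by simp
  moreover have "polyhedral_cone C" if "C \<in> ?F" for C
    using that polyhedral_cone_linear_image[OF polyhedral_cone_trop_cone linear_trop_map] by blast
  moreover have "\<Union>?F = {M. transpose M = M \<and> sym_barvinok_rank M \<le> enat r}"
  proof (intro equalityI subsetI CollectI)
    fix M assume "M \<in> \<Union>?F"
    then show "transpose M = M \<and> sym_barvinok_rank M \<le> enat r"
      using trop_cone_imp_sym_barvinok_rank_le by blast
  next
    fix M :: "real^'n^'n" assume "M \<in> {M. transpose M = M \<and> sym_barvinok_rank M \<le> enat r}"
    then show "M \<in> \<Union>?F" using sym_barvinok_rank_le_imp_trop_cone[of M r] by blast
  qed
  ultimately show "cone_decomposition ?F {M. transpose M = M \<and> sym_barvinok_rank M \<le> enat r}"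
    unfolding cone_decomposition_def by blast
qed (rule conical_dim_sym_barvinok_rank_ge[OF assms])

theorem theorem3p9:
  fixes r :: nat
  assumes "r \<ge> 1"
  shows "has_conical_dim
           {M :: real^'n^'n. transpose M = M \<and> sym_barvinok_rank M \<le> enat r}
           ((CARD('n) + 1 choose 2) - (CARD('n) + 1 - r choose 2))
       \<and> krull_dim (subtopology zariski
           {A :: complex^'n^'n. transpose A = A \<and> rank A \<le> r})
         = enat ((CARD('n) + 1 choose 2) - (CARD('n) + 1 - r choose 2))"
  using assms has_conical_dim_sym_barvinok_rank_le[of r] krull_dim_sym_rank_le[of r] by simp

end
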